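(* Let $G$ be a finite group, let $(Kf)(h)=\frac1{|G|}\sum_{g\in G}k(h^{-1}g)f(g)$ be a left invariant Markov map on $\ell_\infty(G)$, let $u:G\to\mathcal{U}(\mathcal{H})$ be a projective unitary representation on a finite dimensional Hilbert space $\mathcal{H}$, and let $\mathcal{P}(x)=\frac1{|G|}\sum_{g\in G}k(g)u(g)xu(g)^*$ be the transferred quantum channel on $\mathcal{B}(\mathcal{H})$. Let $S\subset G$ and $w:S\to(0,\infty)$, and set $(\nabla_gf)(h)=\sqrt{w(g)}\,(f(hg)-f(h))$, $\partial_g(x)=\sqrt{w(g)}\,(u(g)xu(g)^*-x)$ for $g\in S$, $\nabla=(\nabla_g)_{g\in S}$, $\partial=(\partial_g)_{g\in S}$. (i) Suppose that $|\nabla K(f)|^2\le(1-\kappa)K(|\nabla f|^2)$ pointwise for any $f\in\ell_\infty(G)$, where $|\nabla f|^2=\sum_{g\in S}|\nabla_gf|^2$. Then for all $s\in[0,1]$, all positive operators $A,B\in\mathcal{B}(\mathcal{H})$ and all $x\in\mathcal{B}(\mathcal{H})$, $$\langle\partial\mathcal{P}(x),\partial\mathcal{P}(x)\rangle_{A,B,s}\le(1-\kappa)\langle\partial x,\partial x\rangle_{\mathcal{P}^\dagger(A),\mathcal{P}^\dagger(B),s},$$ where $\langle\mathbf{x},\mathbf{y}\rangle_{A,B,s}=\sum_{g\in S}\mathrm{Tr}(x_g^*A^sy_gB^{1-s})$. (ii) For $1\le p\le\infty$, $1/p+1/p'=1$, and $\mathbf{x}=(x_g)\in\bigoplus_{g\in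 S}\mathcal{B}(\mathcal{H})$ let $\|\mathbf{x}\|_{\infty,p}=\sup_{\|A\|_{p'}\le1}\sup_{h\in S}|\mathrm{Tr}(Ax_h)|$. Suppose that $\|K(f)\|_{\mathrm{Lip}}\le(1-\kappa)\|f\|_{\mathrm{Lip}}$ for any $f\in\ell_\infty(G)$, where $\|f\|_{\mathrm{Lip}}=\sup_{g\in G,h\in S}\sqrt{w(h)}\,|f(g)-f(gh)|$. Then for all $1\le p\le\infty$ and all $x\in\mathcal{B}(\mathcal{H})$, $$\|\partial\mathcal{P}(x)\|_{\infty,p}\le(1-\kappa)\|\partial x\|_{\infty,p}.$$
   Context: $k\ge0$ is a kernel function on $G$ with $\frac1{|G|}\sum_gk(g)=1$. $\ell_\infty(G)$ is the algebra of complex-valued functions on $G$. $\mathcal{P}^\dagger$ is the adjoint of $\mathcal{P}$ for the trace inner product. $\|A\|_{p'}$ is the Schatten norm. *)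

theory Defs
  imports
    "HOL-Analysis.Analysis"
    "HOL-Algebra.Group"
    "HOL-Library.Complex_Order"
begin

text \<open>
  The Hilbert space is \<open>complex ^ 'n\<close> and its operators are the matrices \<open>complex ^ 'n ^ 'n\<close>.
\<close>

definition adj :: "complex ^ 'n ^ 'n \<Rightarrow> complex ^ 'n ^ 'n" where
  "adj A = (\<chi> i j. cnj (A $ j $ i))"

definition unitary :: "complex ^ 'n ^ 'n \<Rightarrow> bool" where
  "unitary U \<longleftrightarrow> adj U ** U = mat 1 \<and> U ** adj U = mat 1"

text \<open>
  Positive means positive semidefinite.  In the order on \<^typ>\<open>complex\<close> from
  \<^theory>\<open>HOL-Library.Complex_Order\<close>, \<open>0 \<le> z\<close> says that \<open>z\<close> is real and nonnegative.
\<close>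

definition positive_op :: "complex ^ 'n ^ 'n \<Rightarrow> bool" where
  "positive_op A \<longleftrightarrow> (\<forall>v. 0 \<le> (\<Sum>i\<in>UNIV. cnj (v $ i) * (A *v v) $ i))"

definition diag_op :: "('n \<Rightarrow> real) \<Rightarrow> complex ^ 'n ^ 'n" where
  "diag_op d = (\<chi> i j. if i = j then complex_of_real (d i) else 0)"

text \<open>
  Functional calculus for a Hermitian matrix.  The value does not depend on the
  diagonalization (lemma \<open>fun_calc_eq\<close>).
\<close>

definition fun_calc :: "(real \<Rightarrow> real) \<Rightarrow> complex ^ 'n ^ 'n \<Rightarrow> complex ^ 'n ^ 'n" where
  "fun_calc \<phi> A = (THE B. \<exists>U d. unitary U \<and> A = U ** diag_op d ** adj U \<and>
                                B = U ** diag_op (\<lambda>i. \<phi> (d i)) ** adj U)"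

text \<open>
  Powers of positive operators.  The zeroth power is the identity (also for singular
  operators), whereas \<open>0 powr 0 = 0\<close> in the library; hence the case distinction.
\<close>

definition op_powr :: "complex ^ 'n ^ 'n \<Rightarrow> real \<Rightarrow> complex ^ 'n ^ 'n" where
  "op_powr A s = fun_calc (\<lambda>t. if s = 0 then 1 else t powr s) A"

definition abs_op :: "complex ^ 'n ^ 'n \<Rightarrow> complex ^ 'n ^ 'n" where
  "abs_op A = fun_calc sqrt (adj A ** A)"

definition schatten_norm :: "ennreal \<Rightarrow> complex ^ 'n ^ 'n \<Rightarrow> real" where
  "schatten_norm p A =
     (if p = \<infinity> then onorm ((*v) A)
      else Re (trace (op_powr (abs_op A) (enn2real p))) powr (1 / enn2real p))"

text \<open>The trace inner product is \<open>Tr (x\<^sup>* y)\<close>; the choice is unique, see lemma \<open>trace_adjoint_eq\<close>.\<close>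

definition trace_adjoint ::
    "(complex ^ 'n ^ 'n \<Rightarrow> complex ^ 'n ^ 'n) \<Rightarrow> complex ^ 'n ^ 'n \<Rightarrow> complex ^ 'n ^ 'n" where
  "trace_adjoint \<Phi> = (THE \<Psi>. \<forall>x y. trace (adj (\<Phi> x) ** y) = trace (adj x ** \<Psi> y))"

definition projective_unitary_rep ::
    "('a, 'm) monoid_scheme \<Rightarrow> ('a \<Rightarrow> complex ^ 'n ^ 'n) \<Rightarrow> bool" where
  "projective_unitary_rep G u \<longleftrightarrow>
     (\<forall>g\<in>carrier G. unitary (u g)) \<and>
     (\<exists>\<sigma>. \<forall>g\<in>carrier G. \<forall>h\<in>carrier G.
        cmod (\<sigma> g h) = 1 \<and> u g ** u h = mat (\<sigma> g h) ** u (g \<otimes>\<^bsub>G\<^esub> h))"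

definition markov_kernel :: "('a, 'm) monoid_scheme \<Rightarrow> ('a \<Rightarrow> real) \<Rightarrow> bool" where
  "markov_kernel G k \<longleftrightarrow>
     (\<forall>g\<in>carrier G. 0 \<le> k g) \<and> (1 / real (card (carrier G))) * (\<Sum>g\<in>carrier G. k g) = 1"

text \<open>
  Functions on \<open>G\<close> are represented by functions on the ambient type; only their values on
  \<open>carrier G\<close> matter.  The codomain is polymorphic because the map is applied both to
  complex-valued functions and to the real-valued functions \<open>\<bar>\<nabla>f\<bar>\<^sup>2\<close>.
\<close>

definition markov_map ::
    "('a, 'm) monoid_scheme \<Rightarrow> ('a \<Rightarrow> real) \<Rightarrow> ('a \<Rightarrow> 'b::real_vector) \<Rightarrow> 'a \<Rightarrow> 'b" where
  "markov_map G k f h =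
     (1 / real (card (carrier G))) *\<^sub>R (\<Sum>g\<in>carrier G. k (inv\<^bsub>G\<^esub> h \<otimes>\<^bsub>G\<^esub> g) *\<^sub>R f g)"

definition transferred_channel ::
    "('a, 'm) monoid_scheme \<Rightarrow> ('a \<Rightarrow> real) \<Rightarrow> ('a \<Rightarrow> complex ^ 'n ^ 'n)
       \<Rightarrow> complex ^ 'n ^ 'n \<Rightarrow> complex ^ 'n ^ 'n" where
  "transferred_channel G k u x =
     (1 / real (card (carrier G))) *\<^sub>R (\<Sum>g\<in>carrier G. k g *\<^sub>R (u g ** x ** adj (u g)))"

definition grad ::
    "('a, 'm) monoid_scheme \<Rightarrow> ('a \<Rightarrow> real) \<Rightarrow> 'a \<Rightarrow> ('a \<Rightarrow> complex) \<Rightarrow> 'a \<Rightarrow> complex" where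
  "grad G w g f h = sqrt (w g) *\<^sub>R (f (h \<otimes>\<^bsub>G\<^esub> g) - f h)"

definition grad_sq ::
    "('a, 'm) monoid_scheme \<Rightarrow> 'a set \<Rightarrow> ('a \<Rightarrow> real) \<Rightarrow> ('a \<Rightarrow> complex) \<Rightarrow> 'a \<Rightarrow> real" where
  "grad_sq G S w f h = (\<Sum>g\<in>S. (cmod (grad G w g f h))\<^sup>2)"

definition op_grad ::
    "('a \<Rightarrow> complex ^ 'n ^ 'n) \<Rightarrow> ('a \<Rightarrow> real) \<Rightarrow> complex ^ 'n ^ 'n \<Rightarrow> 'a \<Rightarrow> complex ^ 'n ^ 'n" where
  "op_grad u w x g = sqrt (w g) *\<^sub>R (u g ** x ** adj (u g) - x)"

definition weighted_form ::
    "'a set \<Rightarrow> complex ^ 'n ^ 'n \<Rightarrow> complex ^ 'n ^ 'n \<Rightarrow> real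
       \<Rightarrow> ('a \<Rightarrow> complex ^ 'n ^ 'n) \<Rightarrow> ('a \<Rightarrow> complex ^ 'n ^ 'n) \<Rightarrow> complex" where
  "weighted_form S A B s x y =
     (\<Sum>g\<in>S. trace (adj (x g) ** op_powr A s ** y g ** op_powr B (1 - s)))"

text \<open>
  In the following two suprema of nonnegative reals, \<open>0\<close> is inserted so that the supremum
  over an empty \<open>S\<close> is \<open>0\<close>; this changes nothing when \<open>S\<close> is nonempty.
\<close>

definition lip_norm ::
    "('a, 'm) monoid_scheme \<Rightarrow> 'a set \<Rightarrow> ('a \<Rightarrow> real) \<Rightarrow> ('a \<Rightarrow> complex) \<Rightarrow> real" where
  "lip_norm G S w f =
     Sup (insert 0 {sqrt (w h) * cmod (f g - f (g \<otimes>\<^bsub>G\<^esub> h)) | g h. g \<in> carrier G \<and> h \<in> S})"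

text \<open>In \<^typ>\<open>ennreal\<close> one has \<open>1 / \<infinity> = 0\<close> and \<open>1 / 0 = \<infinity>\<close>, so for \<open>1 \<le> p\<close> the exponent \<open>p'\<close>
  below is unique.\<close>

definition inf_schatten_norm :: "'a set \<Rightarrow> ennreal \<Rightarrow> ('a \<Rightarrow> complex ^ 'n ^ 'n) \<Rightarrow> real" where
  "inf_schatten_norm S p x =
     Sup (insert 0 {cmod (trace (A ** x h)) | A h p'.
                      1 / p + 1 / p' = 1 \<and> schatten_norm p' A \<le> 1 \<and> h \<in> S})"

lemma adj_mult: "adj (A ** B) = adj B ** adj A"
  by (simp add: adj_def matrix_matrix_mult_def vec_eq_iff mult.commute)

lemma adj_adj: "adj (adj A) = A"
  by (simp add: adj_def vec_eq_iff)

lemma diag_op_mult_left: "(diag_op d ** A) $ i $ j = complex_of_real (d i) * A $ i $ j"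
  by (simp add: diag_op_def matrix_matrix_mult_def if_distrib[of "\<lambda>z. z * _"] cong: if_cong)

lemma diag_op_mult_right: "(A ** diag_op d) $ i $ j = A $ i $ j * complex_of_real (d j)"
  by (simp add: diag_op_def matrix_matrix_mult_def if_distrib[of "\<lambda>z. _ * z"] cong: if_cong)

lemma fun_calc_eq:
  assumes U: "unitary U" and A: "A = U ** diag_op d ** adj U"
  shows "fun_calc \<phi> A = U ** diag_op (\<lambda>i. \<phi> (d i)) ** adj U"
  unfolding fun_calc_def
proof (rule the_equality)
  show "\<exists>V e. unitary V \<and> A = V ** diag_op e ** adj V \<and>
          U ** diag_op (\<lambda>i. \<phi> (d i)) ** adj U = V ** diag_op (\<lambda>i. \<phi> (e i)) ** adj V"
    using U A by blast
next
  fix B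
  assume "\<exists>V e. unitary V \<and> A = V ** diag_op e ** adj V \<and> B = V ** diag_op (\<lambda>i. \<phi> (e i)) ** adj V"
  then obtain V e where V: "unitary V" and AV: "A = V ** diag_op e ** adj V"
    and B: "B = V ** diag_op (\<lambda>i. \<phi> (e i)) ** adj V" by blast
  define W where "W = adj V ** U"
  have UU: "adj U ** U = mat 1" "U ** adj U = mat 1" and VV: "adj V ** V = mat 1" "V ** adj V = mat 1"
    using U V by (auto simp: unitary_def)
  have "W ** diag_op d = adj V ** (U ** diag_op d ** adj U) ** U"
    by (simp add: W_def matrix_mul_assoc[symmetric] UU)
  also have "\<dots> = adj V ** (V ** diag_op e ** adj V) ** U" using A AV by simp
  also have "\<dots> = diag_op e ** W"
    by (simp add: W_def matrix_mul_assoc VV)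
  finally have WD: "W ** diag_op d = diag_op e ** W" .
  have "W ** diag_op (\<lambda>i. \<phi> (d i)) = diag_op (\<lambda>i. \<phi> (e i)) ** W"
  proof -
    have "W $ i $ j * complex_of_real (\<phi> (d j)) = complex_of_real (\<phi> (e i)) * W $ i $ j" for i j
    proof -
      have "W $ i $ j * complex_of_real (d j) = complex_of_real (e i) * W $ i $ j"
        using WD by (metis diag_op_mult_left diag_op_mult_right)
      then have "W $ i $ j = 0 \<or> d j = e i" by (auto simp: mult.commute)
      then show ?thesis by auto
    qed
    then show ?thesis by (simp add: vec_eq_iff diag_op_mult_left diag_op_mult_right)
  qed
  then have "V ** (W ** diag_op (\<lambda>i. \<phi> (d i))) ** adj U = V ** (diag_op (\<lambda>i. \<phi> (e i)) ** W) ** adj U"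
    by simp
  moreover have "V ** (W ** diag_op (\<lambda>i. \<phi> (d i))) ** adj U = U ** diag_op (\<lambda>i. \<phi> (d i)) ** adj U"
    by (simp add: W_def matrix_mul_assoc VV)
  moreover have "V ** (diag_op (\<lambda>i. \<phi> (e i)) ** W) ** adj U = B"
    by (simp add: W_def B matrix_mul_assoc[symmetric] UU)
  ultimately show "B = U ** diag_op (\<lambda>i. \<phi> (d i)) ** adj U" by simp
qed

lemma trace_adj_mult: "trace (adj x ** y) = (\<Sum>i\<in>UNIV. \<Sum>j\<in>UNIV. cnj (x $ j $ i) * y $ j $ i)"
  by (simp add: trace_def adj_def matrix_matrix_mult_def)

lemma trace_adj_nondegenerate:
  assumes "\<And>x. trace (adj x ** y) = trace (adj x ** z)"
  shows "y = z"
proof -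
  have "y $ a $ b = z $ a $ b" for a b
  proof -
    define x :: "complex ^ 'a ^ 'a" where "x = (\<chi> j i. if j = a \<and> i = b then 1 else 0)"
    have "trace (adj x ** v) = v $ a $ b" for v :: "complex ^ 'a ^ 'a"
    proof -
      have "trace (adj x ** v) = (\<Sum>i\<in>UNIV. \<Sum>j\<in>UNIV. if j = a then (if i = b then v $ j $ i else 0) else 0)"
        unfolding trace_adj_mult x_def by (intro sum.cong) auto
      then show ?thesis by simp
    qed
    then show ?thesis using assms[of x] by simp
  qed
  then show ?thesis by (simp add: vec_eq_iff)
qed

lemma trace_adjoint_eq:
  assumes "\<And>x y. trace (adj (\<Phi> x) ** y) = trace (adj x ** \<Psi> y)"
  shows "trace_adjoint \<Phi> = \<Psi>"
  unfolding trace_adjoint_def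
proof (rule the_equality)
  show "\<forall>x y. trace (adj (\<Phi> x) ** y) = trace (adj x ** \<Psi> y)" using assms by blast
next
  fix \<Psi>'
  assume *: "\<forall>x y. trace (adj (\<Phi> x) ** y) = trace (adj x ** \<Psi>' y)"
  show "\<Psi>' = \<Psi>"
  proof
    fix y show "\<Psi>' y = \<Psi> y" by (rule trace_adj_nondegenerate) (metis * assms)
  qed
qed

end

theory Submission
  imports Defs
begin

text \<open>
  The map \<open>x \<mapsto> (h \<mapsto> u(h) x u(h)\<^sup>*)\<close> turns the operator \<open>x\<close> into a matrix-valued function on \<open>G\<close>;
  since the phases of \<open>u\<close> cancel, it intertwines the channel \<open>\<P>\<close> with \<open>K\<close> and the derivations
  \<open>\<partial>\<^sub>g\<close> with \<open>\<nabla>\<^sub>g\<close>.  For (i), write \<open>Tr(y\<^sup>* A\<^sup>s y B\<^sup>1\<^sup>-\<^sup>s)\<close> as a squared Hilbert-Schmidt norm of \<open>C y D\<close>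
  and apply the scalar gradient estimate to the entries of \<open>C u(h) x u(h)\<^sup>* D\<close>; the average over \<open>G\<close>
  on the right hand side is then moved into the weights \<open>A\<close>, \<open>B\<close> by Lieb's concavity theorem.
  For (ii), apply the Lipschitz estimate to the functions \<open>h \<mapsto> Tr(A u(h) x u(h)\<^sup>*)\<close> and use the unitary
  invariance of the Schatten norms.  If \<open>\<kappa> > 1\<close>, the hypotheses force the right hand sides to vanish.

  Lieb's concavity theorem is obtained from the integral representation of \<open>a\<^sup>s b\<^sup>1\<^sup>-\<^sup>s\<close> as a multiple of
  \<open>\<integral>\<^sub>0\<^sup>\<infinity> l\<^sup>s\<^sup>-\<^sup>2 (a : l b) dl\<close>, where \<open>a : b = a b / (a + b)\<close> is the parallel sum, whose quadratic form is
  an infimum of linear functions of \<open>(a, b)\<close>.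
\<close>

section \<open>Diagonalization of Hermitian matrices\<close>

lemma matrix_mul_sum_left:
  fixes f :: "'i \<Rightarrow> 'a::semiring_1 ^ 'n ^ 'm"
  shows "(\<Sum>i\<in>I. f i) ** B = (\<Sum>i\<in>I. f i ** B)"
  by (simp add: matrix_matrix_mult_def vec_eq_iff sum_distrib_right sum.swap[of _ I])

lemma matrix_mul_sum_right:
  fixes f :: "'i \<Rightarrow> 'a::semiring_1 ^ 'n ^ 'm"
  shows "B ** (\<Sum>i\<in>I. f i) = (\<Sum>i\<in>I. B ** f i)"
  by (induction I rule: infinite_finite_induct) (simp_all add: matrix_add_ldistrib)

lemma matrix_mul_scaleR_left:
  fixes A :: "'a::real_algebra_1 ^ 'n ^ 'm"
  shows "(r *\<^sub>R A) ** B = r *\<^sub>R (A ** B)"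
  by (simp add: matrix_matrix_mult_def vec_eq_iff scaleR_sum_right)

lemma matrix_mul_scaleR_right:
  fixes A :: "'a::real_algebra_1 ^ 'n ^ 'm"
  shows "A ** (r *\<^sub>R B) = r *\<^sub>R (A ** B)"
  by (simp add: matrix_matrix_mult_def vec_eq_iff scaleR_sum_right)

lemma matrix_mul_diff_left:
  fixes A :: "'a::ring_1 ^ 'n ^ 'm"
  shows "(A - B) ** C = A ** C - B ** C"
  by (simp add: matrix_matrix_mult_def vec_eq_iff left_diff_distrib sum_subtractf)

lemma matrix_mul_diff_right:
  fixes A :: "'a::ring_1 ^ 'n ^ 'm"
  shows "A ** (B - C) = A ** B - A ** C"
  by (simp add: matrix_matrix_mult_def vec_eq_iff right_diff_distrib sum_subtractf)

lemma trace_sum: "trace (\<Sum>i\<in>I. f i) = (\<Sum>i\<in>I. trace (f i))"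
  unfolding trace_def by (simp add: sum.swap[of _ I])

lemma trace_scaleR: "trace (r *\<^sub>R A) = r *\<^sub>R trace (A :: complex ^ 'n ^ 'n)"
  by (simp add: trace_def scaleR_sum_right)

lemma adj_sum: "adj (\<Sum>i\<in>I. f i) = (\<Sum>i\<in>I. adj (f i))"
  by (simp add: adj_def vec_eq_iff)

lemma adj_scaleR: "adj (r *\<^sub>R A) = r *\<^sub>R adj A"
  by (simp add: adj_def vec_eq_iff)

lemma adj_diag_op: "adj (diag_op d) = diag_op d"
  by (simp add: adj_def diag_op_def vec_eq_iff)

lemma adj_mat: "adj (mat c) = mat (cnj c)"
  by (simp add: adj_def mat_def vec_eq_iff)

lemma unitaryD: "unitary U \<Longrightarrow> adj U ** U = mat 1" "unitary U \<Longrightarrow> U ** adj U = mat 1"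
  by (simp_all add: unitary_def)

text \<open>A one-sided inverse of a square matrix is two-sided, so unitarity amounts to a single
  continuous equation.\<close>

lemma unitaryI: "adj U ** U = mat 1 \<Longrightarrow> unitary U"
  by (simp add: unitary_def matrix_left_right_inverse)

lemma unitary_adj: "unitary U \<Longrightarrow> unitary (adj U)"
  by (simp add: unitary_def adj_adj)

lemma unitary_mult:
  assumes "unitary U" "unitary V"
  shows "unitary (U ** V)"
proof (rule unitaryI)
  have "adj (U ** V) ** (U ** V) = adj V ** (adj U ** U) ** V"
    by (simp add: adj_mult matrix_mul_assoc)
  then show "adj (U ** V) ** (U ** V) = mat 1"
    using assms by (simp add: unitaryD)
qed

text \<open>The columns of a unitary matrix are unit vectors.\<close>

lemma unitary_entry_le_1:
  assumes "unitary U"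
  shows "cmod (U $ i $ j) \<le> 1"
proof -
  have "(\<Sum>k\<in>UNIV. cnj (U $ k $ j) * U $ k $ j) = 1"
    using unitaryD(1)[OF assms] by (simp add: adj_def matrix_matrix_mult_def mat_def vec_eq_iff)
  then have "complex_of_real (\<Sum>k\<in>UNIV. (cmod (U $ k $ j))\<^sup>2) = 1"
    by (simp add: complex_norm_square mult.commute del: of_real_power)
  then have "(\<Sum>k\<in>UNIV. (cmod (U $ k $ j))\<^sup>2) = 1"
    using of_real_eq_1_iff by blast
  then have "(cmod (U $ i $ j))\<^sup>2 \<le> 1"
    using member_le_sum[of i UNIV "\<lambda>k. (cmod (U $ k $ j))\<^sup>2"] by simp
  then show ?thesis by (simp add: power_le_one_iff)
qed

section \<open>Compactness of the unitary group\<close>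

lemma bounded_entries:
  fixes M :: "('a::real_normed_vector ^ 'n ^ 'm) set"
  assumes "\<And>A i j. A \<in> M \<Longrightarrow> norm (A $ i $ j) \<le> c"
  shows "bounded M"
  unfolding bounded_iff
proof (intro exI ballI)
  fix A assume "A \<in> M"
  have "norm A \<le> (\<Sum>i\<in>UNIV. norm (A $ i))"
    unfolding norm_vec_def by (rule L2_set_le_sum) simp
  also have "\<dots> \<le> (\<Sum>i\<in>(UNIV :: 'm set). \<Sum>j\<in>(UNIV :: 'n set). c)"
  proof (rule sum_mono)
    fix i
    have "norm (A $ i) \<le> (\<Sum>j\<in>UNIV. norm (A $ i $ j))"
      unfolding norm_vec_def[of "A $ i"] by (rule L2_set_le_sum) simp
    also have "\<dots> \<le> (\<Sum>j\<in>(UNIV :: 'n set). c)"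
      using assms[OF \<open>A \<in> M\<close>] by (intro sum_mono)
    finally show "norm (A $ i) \<le> (\<Sum>j\<in>(UNIV :: 'n set). c)" .
  qed
  finally show "norm A \<le> (\<Sum>i\<in>(UNIV :: 'm set). \<Sum>j\<in>(UNIV :: 'n set). c)" .
qed

lemma continuous_on_adj [continuous_intros]:
  "continuous_on T f \<Longrightarrow> continuous_on T (\<lambda>x. adj (f x))"
  unfolding adj_def by (intro continuous_intros)

lemma continuous_on_matrix_mult [continuous_intros]:
  fixes f :: "'b::topological_space \<Rightarrow> 'a::real_normed_algebra_1 ^ 'n ^ 'm"
  assumes "continuous_on T f" "continuous_on T g"
  shows "continuous_on T (\<lambda>x. f x ** g x)"
  unfolding matrix_matrix_mult_def by (intro continuous_intros assms)

text \<open>Closed as the solution set of one continuous equation and bounded entry by entry. This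
  supplies the maximizer in the diagonalization argument.\<close>

lemma compact_unitary: "compact {U :: complex ^ 'n ^ 'n. unitary U}"
proof -
  have "{U :: complex ^ 'n ^ 'n. unitary U} = {U. adj U ** U = mat 1}"
    using unitaryI unitaryD by blast
  moreover have "closed {U :: complex ^ 'n ^ 'n. adj U ** U = mat 1}"
    by (intro closed_Collect_eq continuous_intros)
  moreover have "bounded {U :: complex ^ 'n ^ 'n. unitary U}"
    by (rule bounded_entries[where c = 1]) (simp add: unitary_entry_le_1)
  ultimately show ?thesis by (simp add: compact_eq_bounded_closed)
qed

section \<open>Plane rotations and diagonalization\<close>

lemma sum_UNIV_two:
  fixes f :: "'n::finite \<Rightarrow> 'a::comm_monoid_add"
  assumes "i \<noteq> j" "\<And>k. k \<noteq> i \<Longrightarrow> k \<noteq> j \<Longrightarrow> f k = 0"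
  shows "sum f UNIV = f i + f j"
proof -
  have "sum f UNIV = sum f {i, j}"
    by (rule sum.mono_neutral_right) (use assms in auto)
  then show ?thesis using assms by simp
qed

text \<open>The plane rotation with columns \<open>(e\<^sub>i + t \<omega>\<^sup>* e\<^sub>j) / r\<close> and \<open>(e\<^sub>j - t \<omega> e\<^sub>i) / r\<close>, where \<open>r\<^sup>2 = 1 + t\<^sup>2\<close>.\<close>

definition plane_rotation :: "'n \<Rightarrow> 'n \<Rightarrow> complex \<Rightarrow> real \<Rightarrow> complex ^ 'n ^ 'n" where
  "plane_rotation i j \<omega> t = (\<chi> p q.
     if q = i then (if p = i then 1 else if p = j then of_real t * cnj \<omega> else 0) / of_real (sqrt (1 + t\<^sup>2))
     else if q = j then (if p = j then 1 else if p = i then - of_real t * \<omega> else 0) / of_real (sqrt (1 + t\<^sup>2))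
     else if p = q then 1 else 0)"

lemma plane_rotation_entries:
  assumes "i \<noteq> j"
  shows "plane_rotation i j \<omega> t $ i $ i = 1 / of_real (sqrt (1 + t\<^sup>2))"
    and "plane_rotation i j \<omega> t $ j $ i = of_real t * cnj \<omega> / of_real (sqrt (1 + t\<^sup>2))"
    and "plane_rotation i j \<omega> t $ i $ j = - of_real t * \<omega> / of_real (sqrt (1 + t\<^sup>2))"
    and "plane_rotation i j \<omega> t $ j $ j = 1 / of_real (sqrt (1 + t\<^sup>2))"
    and "p \<noteq> i \<Longrightarrow> p \<noteq> j \<Longrightarrow> plane_rotation i j \<omega> t $ p $ q = (if p = q then 1 else 0)"
    and "q \<noteq> i \<Longrightarrow> q \<noteq> j \<Longrightarrow> plane_rotation i j \<omega> t $ p $ q = (if p = q then 1 else 0)"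
  using assms by (auto simp: plane_rotation_def)

lemma of_real_sqrt_square: "0 \<le> a \<Longrightarrow> complex_of_real (sqrt a) * complex_of_real (sqrt a) = of_real a"
  by (metis of_real_mult real_sqrt_mult_self abs_of_nonneg)

lemma unitary_plane_rotation:
  assumes ij: "i \<noteq> j" and \<omega>: "cmod \<omega> = 1"
  shows "unitary (plane_rotation i j \<omega> t)" (is "unitary ?R")
proof (rule unitaryI)
  define r where "r = complex_of_real (sqrt (1 + t\<^sup>2))"
  have rr: "r * r = 1 + (of_real t)\<^sup>2" and cr: "cnj r = r"
    unfolding r_def by (subst of_real_sqrt_square) auto
  have r0: "r \<noteq> 0"
    unfolding r_def of_real_eq_0_iff
    by (metis add_pos_nonneg less_numeral_extra(1,3) real_sqrt_eq_zero_cancel_iff zero_le_power2)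
  have ww: "\<omega> * cnj \<omega> = 1" using \<omega> by (metis complex_norm_square of_real_1 one_power2)
  have wwt: "\<omega> * (cnj \<omega> * a) = a" for a by (simp add: mult.assoc[symmetric] ww)
  note E = plane_rotation_entries[OF ij, where \<omega> = \<omega> and t = t, folded r_def]
  have "(adj ?R ** ?R) $ p $ q = mat 1 $ p $ q" for p q
  proof -
    have *: "(adj ?R ** ?R) $ p $ q = (\<Sum>k\<in>UNIV. cnj (?R $ k $ p) * ?R $ k $ q)"
      by (simp add: adj_def matrix_matrix_mult_def)
    \<comment> \<open>Outside the plane of \<open>i\<close> and \<open>j\<close> the columns of the
      rotation are standard basis vectors; inside, only the rows \<open>i\<close> and
      \<open>j\<close> contribute.\<close>
    consider "p \<noteq> i" "p \<noteq> j" | "q \<noteq> i" "q \<noteq> j" | "p \<in> {i, j}" "q \<in> {i, j}" by blast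
    then show ?thesis
    proof cases
      case 1
      then show ?thesis unfolding *
        by (simp add: E(6) E(5) mat_def if_distrib[of "\<lambda>z. z * _"] if_distrib[of cnj] cong: if_cong)
    next
      case 2
      then show ?thesis unfolding *
        by (auto simp add: E(6) E(5) mat_def if_distrib[of "\<lambda>z. _ * z"] cong: if_cong)
    next
      case 3
      then have "(\<Sum>k\<in>UNIV. cnj (?R $ k $ p) * ?R $ k $ q) =
          cnj (?R $ i $ p) * ?R $ i $ q + cnj (?R $ j $ p) * ?R $ j $ q"
        by (intro sum_UNIV_two ij) (auto simp: E(5))
      then show ?thesis unfolding *
        using 3 r0 ij ww by (auto simp: E(1-4) mat_def cr field_simps)
          (simp_all add: rr wwt power2_eq_square)
    qed
  qed
  then show "adj ?R ** ?R = mat 1" by (simp add: vec_eq_iff)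
qed

lemma conj_diag_entry:
  "(adj R ** M ** R) $ k $ k = (\<Sum>p\<in>UNIV. cnj (R $ p $ k) * (\<Sum>q\<in>UNIV. M $ p $ q * R $ q $ k))"
  by (simp add: matrix_mul_assoc[symmetric]) (simp add: matrix_matrix_mult_def adj_def)

text \<open>With the phase of \<open>M $ i $ j\<close> as \<omega>, the two cross terms become real
  and equal, and add up to \<open>2 * t * m\<close> for \<open>m = cmod (M $ i $ j)\<close>. The
  trace is preserved, so what one of the two diagonal entries gains the other loses, to first order
  in \<open>t\<close>.\<close>

lemma plane_rotation_conj:
  fixes M :: "complex ^ 'n ^ 'n" and t :: real
  assumes ij: "i \<noteq> j" and M: "adj M = M" and nz: "M $ i $ j \<noteq> 0"
  defines "R \<equiv> plane_rotation i j (sgn (M $ i $ j)) t"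
  shows "k \<noteq> i \<Longrightarrow> k \<noteq> j \<Longrightarrow> (adj R ** M ** R) $ k $ k = M $ k $ k"
    and "(adj R ** M ** R) $ i $ i =
      (M $ i $ i + of_real (2 * t * cmod (M $ i $ j)) + of_real (t\<^sup>2) * M $ j $ j) / of_real (1 + t\<^sup>2)"
    and "(adj R ** M ** R) $ j $ j =
      (M $ j $ j - of_real (2 * t * cmod (M $ i $ j)) + of_real (t\<^sup>2) * M $ i $ i) / of_real (1 + t\<^sup>2)"
proof -
  define \<omega> where "\<omega> = sgn (M $ i $ j)"
  define r where "r = complex_of_real (sqrt (1 + t\<^sup>2))"
  define m where "m = complex_of_real (cmod (M $ i $ j))"
  have rr: "r * r = of_real (1 + t\<^sup>2)" and cr: "cnj r = r"
    unfolding r_def by (subst of_real_sqrt_square) auto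
  have ww: "\<omega> * cnj \<omega> = 1"
    unfolding \<omega>_def using nz by (metis complex_norm_square norm_sgn of_real_1 one_power2)
  have cm: "cnj m = m" by (simp add: m_def)
  have Mij: "M $ i $ j = m * \<omega>"
    using nz by (simp add: \<omega>_def m_def sgn_eq)
  have "M $ j $ i = cnj (M $ i $ j)"
    using arg_cong[OF M, of "\<lambda>X. X $ j $ i"] by (simp add: adj_def)
  then have Mji: "M $ j $ i = m * cnj \<omega>"
    by (simp add: Mij cm)
  note E = plane_rotation_entries[OF ij, where \<omega> = \<omega> and t = t, folded r_def, folded R_def[folded \<omega>_def]]
  show "(adj R ** M ** R) $ k $ k = M $ k $ k" if "k \<noteq> i" "k \<noteq> j"
    unfolding conj_diag_entry using that
    by (simp add: E(6) if_distrib[of "\<lambda>z. z * _"] if_distrib[of "\<lambda>z. _ * z"] if_distrib[of cnj] cong: if_cong)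
  have two: "(adj R ** M ** R) $ k $ k =
      cnj (R $ i $ k) * (M $ i $ i * R $ i $ k + M $ i $ j * R $ j $ k) +
      cnj (R $ j $ k) * (M $ j $ i * R $ i $ k + M $ j $ j * R $ j $ k)" if "k \<in> {i, j}" for k
  proof -
    have "(\<Sum>q\<in>UNIV. M $ p $ q * R $ q $ k) = M $ p $ i * R $ i $ k + M $ p $ j * R $ j $ k" for p
      using that by (intro sum_UNIV_two ij) (auto simp: E(5))
    then show ?thesis
      unfolding conj_diag_entry using that by (subst sum_UNIV_two[OF ij]) (auto simp: E(5))
  qed
  have "(adj R ** M ** R) $ i $ i =
      (M $ i $ i + of_real t * m * (\<omega> * cnj \<omega>) * 2 + (of_real t)\<^sup>2 * (\<omega> * cnj \<omega>) * M $ j $ j) / (r * r)"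
    by (subst two) (simp_all add: E cr Mij Mji add_divide_distrib algebra_simps power2_eq_square)
  then show "(adj R ** M ** R) $ i $ i =
      (M $ i $ i + of_real (2 * t * cmod (M $ i $ j)) + of_real (t\<^sup>2) * M $ j $ j) / of_real (1 + t\<^sup>2)"
    by (simp add: rr ww m_def mult_ac)
  have "(adj R ** M ** R) $ j $ j =
      (M $ j $ j - of_real t * m * (\<omega> * cnj \<omega>) * 2 + (of_real t)\<^sup>2 * (\<omega> * cnj \<omega>) * M $ i $ i) / (r * r)"
    by (subst two) (simp_all add: E cr Mij Mji add_divide_distrib diff_divide_distrib algebra_simps power2_eq_square)
  then show "(adj R ** M ** R) $ j $ j =
      (M $ j $ j - of_real (2 * t * cmod (M $ i $ j)) + of_real (t\<^sup>2) * M $ i $ i) / of_real (1 + t\<^sup>2)"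
    by (simp add: rr ww m_def mult_ac)
qed

text \<open>A maximizer of \<open>\<Sum>\<^sub>i c\<^sub>i (U\<^sup>* A U)\<^sub>i\<^sub>i\<close> with distinct weights \<open>c\<^sub>i\<close> over the unitary group
  diagonalizes \<open>A\<close>, since a small plane rotation would increase the sum as long as there is a
  nonzero off-diagonal entry.\<close>

theorem hermitian_diagonalization:
  fixes A :: "complex ^ 'n ^ 'n"
  assumes A: "adj A = A"
  obtains U d where "unitary U" "A = U ** diag_op d ** adj U"
proof -
  \<comment> \<open>The weights have to be distinct: an exchange between two diagonal entries of
    equal weight would not change the sum.\<close>
  obtain c0 :: "'n \<Rightarrow> nat" where "inj c0"
    using finite_imp_inj_to_nat_seg[of "UNIV :: 'n set"] by auto
  define c where "c i = real (c0 i)" for i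
  have c: "c i \<noteq> c j" if "i \<noteq> j" for i j
    using \<open>inj c0\<close> that by (simp add: c_def inj_eq)
  define F where "F U = (\<Sum>i\<in>UNIV. c i * Re ((adj U ** A ** U) $ i $ i))" for U
  have "continuous_on {U. unitary U} F"
    unfolding F_def by (intro continuous_intros)
  moreover have "{U :: complex ^ 'n ^ 'n. unitary U} \<noteq> {}"
    by (metis unitaryI adj_mat complex_cnj_one matrix_mul_lid mem_Collect_eq empty_iff)
  ultimately obtain U where U: "unitary U" and max: "\<And>V. unitary V \<Longrightarrow> F V \<le> F U"
    using continuous_attains_sup[OF compact_unitary, of F] by auto
  define M where "M = adj U ** A ** U"
  have M: "adj M = M"
    by (simp add: M_def adj_mult adj_adj A matrix_mul_assoc)
  have offdiag: "M $ i $ j = 0" if ij: "i \<noteq> j" for i j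
  proof (rule ccontr)
    assume nz: "M $ i $ j \<noteq> 0"
    define m where "m = cmod (M $ i $ j)"
    define D where "D = Re (M $ j $ j) - Re (M $ i $ i)"
    \<comment> \<open>The sign of \<open>t\<close> makes the first-order gain positive. Its size
      keeps \<open>\<bar>t * D\<bar>\<close> at most \<open>m\<close>, so that the second-order term
      cannot outweigh \<open>2 * m\<close>.\<close>
    define t where "t = sgn (c i - c j) * (m / (\<bar>D\<bar> + 1))"
    define R where "R = plane_rotation i j (sgn (M $ i $ j)) t"
    define N where "N = adj R ** M ** R"
    note N = plane_rotation_conj[OF ij M nz, where t = t, folded R_def N_def, folded m_def]
    have "0 < m" using nz by (simp add: m_def)
    have pos: "0 < 1 + t\<^sup>2" by (simp add: add_pos_nonneg)
    have Re_div: "Re (z / of_real a) = Re z / a" for z a by simp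
    have "F (U ** R) = (\<Sum>k\<in>UNIV. c k * Re (N $ k $ k))"
      by (simp add: F_def N_def M_def adj_mult matrix_mul_assoc)
    then have "F (U ** R) - F U = (\<Sum>k\<in>UNIV. c k * (Re (N $ k $ k) - Re (M $ k $ k)))"
      by (simp add: F_def M_def sum_subtractf right_diff_distrib)
    also have "\<dots> = c i * (Re (N $ i $ i) - Re (M $ i $ i)) + c j * (Re (N $ j $ j) - Re (M $ j $ j))"
      by (intro sum_UNIV_two ij) (simp add: N(1))
    also have "Re (N $ i $ i) - Re (M $ i $ i) = (2 * t * m + t\<^sup>2 * D) / (1 + t\<^sup>2)"
      using pos unfolding N(2) Re_div by (simp add: D_def field_simps)
    also have "Re (N $ j $ j) - Re (M $ j $ j) = - (2 * t * m + t\<^sup>2 * D) / (1 + t\<^sup>2)"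
      using pos unfolding N(3) Re_div by (simp add: D_def field_simps)
    finally have "F (U ** R) - F U = (c i - c j) * t * (2 * m + t * D) / (1 + t\<^sup>2)"
      by (simp add: power2_eq_square algebra_simps diff_divide_distrib add_divide_distrib)
    moreover have "0 < (c i - c j) * t"
    proof -
      have "(c i - c j) * t = \<bar>c i - c j\<bar> * (m / (\<bar>D\<bar> + 1))"
        by (simp add: t_def abs_sgn)
      then show ?thesis using c[OF ij] \<open>0 < m\<close> by simp
    qed
    moreover have "0 < 2 * m + t * D"
    proof -
      have "\<bar>t * D\<bar> = m * (\<bar>D\<bar> / (\<bar>D\<bar> + 1))"
        using c[OF ij] \<open>0 < m\<close> by (simp add: t_def abs_mult sgn_if)
      also have "\<dots> \<le> m * 1"
        using \<open>0 < m\<close> by (intro mult_left_mono) auto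
      finally show ?thesis using \<open>0 < m\<close> by linarith
    qed
    ultimately have "F U < F (U ** R)"
      using pos by (metis diff_gt_0_iff_gt divide_pos_pos mult_pos_pos)
    moreover have "unitary (U ** R)"
      unfolding R_def using nz by (intro unitary_mult U unitary_plane_rotation ij) (simp add: norm_sgn)
    ultimately show False using max by (meson not_le)
  qed
  define d where "d i = Re (M $ i $ i)" for i
  have "M $ i $ j = diag_op d $ i $ j" for i j
  proof (cases "i = j")
    case True
    have "cnj (M $ i $ i) = M $ i $ i"
      using arg_cong[OF M, of "\<lambda>X. X $ i $ i"] by (simp add: adj_def)
    then show ?thesis using True by (simp add: diag_op_def d_def complex_eq_iff)
  qed (simp add: offdiag diag_op_def)
  then have "M = diag_op d" by (simp add: vec_eq_iff)
  moreover have "U ** M ** adj U = (U ** adj U) ** A ** (U ** adj U)"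
    by (simp add: M_def matrix_mul_assoc)
  ultimately have "A = U ** diag_op d ** adj U"
    using U by (simp add: unitaryD)
  with U that show ?thesis by blast
qed

section \<open>Lieb's concavity theorem\<close>

lemma positive_op_form_two:
  fixes A :: "complex ^ 'n ^ 'n"
  assumes "positive_op A" and jk: "j \<noteq> k"
  shows "0 \<le> A $ j $ j + A $ j $ k * c + cnj c * (A $ k $ j + A $ k $ k * c)"
proof -
  define v :: "complex ^ 'n" where "v = (\<chi> i. if i = j then 1 else if i = k then c else 0)"
  have Av: "(A *v v) $ i = A $ i $ j + A $ i $ k * c" for i
    unfolding matrix_vector_mult_def
    by (simp, subst sum_UNIV_two[OF jk]) (use jk in \<open>auto simp: v_def\<close>)
  have "(\<Sum>i\<in>UNIV. cnj (v $ i) * (A *v v) $ i)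
      = A $ j $ j + A $ j $ k * c + cnj c * (A $ k $ j + A $ k $ k * c)"
    by (subst sum_UNIV_two[OF jk]) (use jk in \<open>auto simp: v_def Av[unfolded v_def]\<close>)
  then show ?thesis using assms(1) unfolding positive_op_def by metis
qed

lemma positive_op_diag_nonneg:
  fixes A :: "complex ^ 'n ^ 'n"
  assumes "positive_op A"
  shows "0 \<le> A $ j $ j"
proof -
  have "(\<Sum>i\<in>UNIV. cnj (axis j 1 $ i) * (A *v axis j 1) $ i) = A $ j $ j"
    by (simp add: matrix_vector_mult_def axis_def if_distrib[of "\<lambda>z. z * _"] if_distrib[of "\<lambda>z. _ * z"]
        if_distrib[of cnj] cong: if_cong)
  then show ?thesis using assms unfolding positive_op_def by metis
qed

text \<open>Polarization: the form is real at \<open>e_j + e_k\<close> and at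
  \<open>e_j + i e_k\<close>, which kills the imaginary part of \<open>A $ j $ k + A $ k $ j\<close>
  and the real part of \<open>A $ j $ k - A $ k $ j\<close>.\<close>

lemma positive_op_hermitian:
  assumes A: "positive_op A"
  shows "adj A = A"
proof -
  have "cnj (A $ k $ j) = A $ j $ k" for j k
  proof (cases "j = k")
    case True
    then show ?thesis using positive_op_diag_nonneg[OF A, of j]
      by (simp add: complex_eq_iff less_eq_complex_def)
  next
    case False
    have "Im (A $ j $ k + A $ k $ j) = 0"
      using positive_op_form_two[OF A False, of 1]
        positive_op_diag_nonneg[OF A, of j] positive_op_diag_nonneg[OF A, of k]
      by (simp add: less_eq_complex_def)
    moreover have "Re (A $ j $ k - A $ k $ j) = 0"
      using positive_op_form_two[OF A False, of \<i>]
        positive_op_diag_nonneg[OF A, of j] positive_op_diag_nonneg[OF A, of k]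
      by (simp add: less_eq_complex_def)
    ultimately show ?thesis by (simp add: complex_eq_iff)
  qed
  then show ?thesis by (simp add: adj_def vec_eq_iff)
qed

lemma sum_adj_mult_vec:
  "(\<Sum>i\<in>UNIV. cnj (v $ i) * (adj V *v z) $ i) = (\<Sum>i\<in>UNIV. cnj ((V *v v) $ i) * z $ i)"
  by (simp add: matrix_vector_mult_def adj_def sum_distrib_left sum_distrib_right)
    (subst sum.swap, simp add: mult_ac)

lemma positive_op_conj:
  assumes "positive_op A"
  shows "positive_op (adj V ** A ** V)"
  unfolding positive_op_def
proof
  fix v
  have "(\<Sum>i\<in>UNIV. cnj (v $ i) * ((adj V ** A ** V) *v v) $ i)
      = (\<Sum>i\<in>UNIV. cnj ((V *v v) $ i) * (A *v (V *v v)) $ i)"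
    by (simp add: matrix_vector_mul_assoc[symmetric] sum_adj_mult_vec)
  then show "0 \<le> (\<Sum>i\<in>UNIV. cnj (v $ i) * ((adj V ** A ** V) *v v) $ i)"
    using assms unfolding positive_op_def by metis
qed

lemma positive_op_sum:
  fixes A :: "'i \<Rightarrow> complex ^ 'n ^ 'n"
  assumes "\<And>i. i \<in> I \<Longrightarrow> positive_op (A i)" "\<And>i. i \<in> I \<Longrightarrow> 0 \<le> p i"
  shows "positive_op (\<Sum>i\<in>I. p i *\<^sub>R A i)"
  unfolding positive_op_def
proof
  fix v
  have "((\<Sum>i\<in>I. p i *\<^sub>R A i) *v v) $ k = (\<Sum>i\<in>I. p i *\<^sub>R (A i *v v) $ k)" for k
    by (simp add: matrix_vector_mult_def sum_distrib_right scaleR_sum_right sum.swap[of _ I])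
  then have "(\<Sum>k\<in>UNIV. cnj (v $ k) * ((\<Sum>i\<in>I. p i *\<^sub>R A i) *v v) $ k)
      = (\<Sum>i\<in>I. p i *\<^sub>R (\<Sum>k\<in>UNIV. cnj (v $ k) * (A i *v v) $ k))"
    by (simp add: sum_distrib_left scaleR_sum_right sum.swap[of _ I])
  also have "0 \<le> \<dots>"
    using assms unfolding positive_op_def
    by (intro sum_nonneg) (simp add: less_eq_complex_def)
  finally show "0 \<le> (\<Sum>k\<in>UNIV. cnj (v $ k) * ((\<Sum>i\<in>I. p i *\<^sub>R A i) *v v) $ k)" .
qed

text \<open>The eigenvalues are the diagonal entries of \<open>adj U ** A ** U\<close>, which is
  again positive.\<close>

lemma positive_op_diagonalization:
  fixes A :: "complex ^ 'n ^ 'n"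
  assumes "positive_op A"
  obtains U d where "unitary U" "A = U ** diag_op d ** adj U" "\<And>i. 0 \<le> d i"
proof -
  obtain U d where U: "unitary U" and A: "A = U ** diag_op d ** adj U"
    using hermitian_diagonalization[OF positive_op_hermitian[OF assms]] .
  have "0 \<le> d i" for i
  proof -
    have "adj U ** A ** U = (adj U ** U) ** diag_op d ** (adj U ** U)"
      by (simp add: A matrix_mul_assoc)
    then have "adj U ** A ** U = diag_op d"
      using U by (simp add: unitaryD)
    then have "positive_op (diag_op d)"
      using positive_op_conj[OF assms] by metis
    then show ?thesis
      using positive_op_diag_nonneg[of "diag_op d" i] by (simp add: diag_op_def less_eq_complex_def)
  qed
  with U A that show ?thesis by blast
qed

text \<open>In eigenbases of the two operators, left and right multiplication act entrywise, by the
  eigenvalues. All later computations with two noncommuting operators reduce to weighted sums over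
  the entries of \<open>adj U ** y ** V\<close>.\<close>

lemma trace_diag_form:
  "trace (adj y ** (U ** diag_op \<alpha> ** adj U) ** y ** (V ** diag_op \<beta> ** adj V))
    = complex_of_real (\<Sum>i\<in>UNIV. \<Sum>j\<in>UNIV. \<alpha> i * \<beta> j * (cmod ((adj U ** y ** V) $ i $ j))\<^sup>2)"
proof -
  define z where "z = adj U ** y ** V"
  have "trace (adj y ** (U ** diag_op \<alpha> ** adj U) ** y ** (V ** diag_op \<beta> ** adj V))
      = trace (adj V ** (adj y ** U ** diag_op \<alpha> ** adj U ** y ** V ** diag_op \<beta>))"
    by (subst trace_mul_sym) (simp add: matrix_mul_assoc)
  also have "\<dots> = trace (adj z ** (diag_op \<alpha> ** z ** diag_op \<beta>))"
    by (simp add: z_def adj_mult adj_adj matrix_mul_assoc)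
  also have "\<dots> = (\<Sum>j\<in>UNIV. \<Sum>i\<in>UNIV. complex_of_real (\<alpha> i * \<beta> j * (cmod (z $ i $ j))\<^sup>2))"
    unfolding trace_adj_mult diag_op_mult_left diag_op_mult_right of_real_mult complex_norm_square
    by (simp add: mult_ac)
  finally show ?thesis
    by (subst sum.swap) (simp add: z_def)
qed

section \<open>Parallel sums of left and right multiplication\<close>

lemma diag_op_one: "diag_op (\<lambda>i. 1) = mat 1"
  by (simp add: diag_op_def mat_def vec_eq_iff)

lemma unitary_conj_one: "unitary U \<Longrightarrow> U ** diag_op (\<lambda>i. 1) ** adj U = mat 1"
  by (simp add: diag_op_one unitaryD)

text \<open>The cost of splitting \<open>y\<close> into \<open>z\<close>, measured by left
  multiplication by \<open>A\<close>, and \<open>y - z\<close>, measured by right multiplication by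
  \<open>l B\<close>.\<close>

definition split_form ::
    "complex ^ 'n ^ 'n \<Rightarrow> complex ^ 'n ^ 'n \<Rightarrow> complex ^ 'n ^ 'n \<Rightarrow> real \<Rightarrow> complex ^ 'n ^ 'n \<Rightarrow> real" where
  "split_form y A B l z = Re (trace (adj z ** A ** z)) + l * Re (trace (adj (y - z) ** (y - z) ** B))"

text \<open>The quadratic form of the parallel sum of left multiplication by \<open>A\<close> and right
  multiplication by \<open>l B\<close>.  As an infimum of linear functions of \<open>(A, B)\<close> it is jointly concave.\<close>

definition parallel_form ::
    "complex ^ 'n ^ 'n \<Rightarrow> complex ^ 'n ^ 'n \<Rightarrow> complex ^ 'n ^ 'n \<Rightarrow> real \<Rightarrow> real" where
  "parallel_form y A B l = (INF z. split_form y A B l z)"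

text \<open>With \<open>p = cmod z\<close> and \<open>q = cmod (y - z)\<close>, combine
  \<open>cmod y \<le> p + q\<close> with the identity
  \<open>a c (p + q)^2 + (a p - c q)^2 = (a p^2 + c q^2) (a + c)\<close>.\<close>

lemma parallel_sum_le:
  fixes y z :: complex and a c :: real
  assumes "0 \<le> a" "0 \<le> c"
  shows "a * c / (a + c) * (cmod y)\<^sup>2 \<le> a * (cmod z)\<^sup>2 + c * (cmod (y - z))\<^sup>2"
proof (cases "a + c = 0")
  case False
  then have pos: "0 < a + c" using assms by simp
  define p q where "p = cmod z" and "q = cmod (y - z)"
  have "cmod y \<le> p + q" unfolding p_def q_def by norm
  then have "(cmod y)\<^sup>2 \<le> (p + q)\<^sup>2" by (simp add: power_mono)
  then have "a * c * (cmod y)\<^sup>2 \<le> a * c * (p + q)\<^sup>2"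
    using assms by (simp add: mult_left_mono)
  also have "\<dots> + (a * p - c * q)\<^sup>2 = (a * p\<^sup>2 + c * q\<^sup>2) * (a + c)"
    by (simp add: power2_eq_square algebra_simps)
  then have "a * c * (p + q)\<^sup>2 \<le> (a * p\<^sup>2 + c * q\<^sup>2) * (a + c)"
    by (metis le_add_same_cancel1 zero_le_power2)
  finally show ?thesis
    using pos by (simp add: p_def q_def field_simps)
qed (use assms in auto)

text \<open>This \<open>z\<close> is the optimal splitting, determined by
  \<open>a z = c (y - z)\<close>.\<close>

lemma parallel_sum_eq:
  fixes y :: complex and a c :: real
  assumes "0 \<le> a" "0 \<le> c"
  defines "z \<equiv> of_real (c / (a + c)) * y"
  shows "a * (cmod z)\<^sup>2 + c * (cmod (y - z))\<^sup>2 = a * c / (a + c) * (cmod y)\<^sup>2"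
proof (cases "a + c = 0")
  case False
  have "y - z = of_real (a / (a + c)) * y"
    using False by (simp add: z_def field_simps flip: of_real_add) (simp add: distrib_left)
  then have Y: "(cmod (y - z))\<^sup>2 = (a / (a + c))\<^sup>2 * (cmod y)\<^sup>2"
    by (simp only: norm_mult norm_of_real power_mult_distrib power2_abs)
  have Z: "(cmod z)\<^sup>2 = (c / (a + c))\<^sup>2 * (cmod y)\<^sup>2"
    by (simp only: z_def norm_mult norm_of_real power_mult_distrib power2_abs)
  have E: "a * (c / (a + c))\<^sup>2 + c * (a / (a + c))\<^sup>2 = a * c * (a + c) / (a + c)\<^sup>2"
    by (simp add: power_divide power2_eq_square add_divide_distrib[symmetric] algebra_simps)
  have "a * (cmod z)\<^sup>2 + c * (cmod (y - z))\<^sup>2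
      = (a * (c / (a + c))\<^sup>2 + c * (a / (a + c))\<^sup>2) * (cmod y)\<^sup>2"
    unfolding Y Z by (simp only: distrib_right mult.assoc)
  also have "\<dots> = a * c / (a + c) * (cmod y)\<^sup>2"
    unfolding E using False by (simp add: power2_eq_square)
  finally show ?thesis .
qed (use assms in auto)

context
  fixes U V A B :: "complex ^ 'n ^ 'n" and a b :: "'n \<Rightarrow> real"
  assumes U: "unitary U" and V: "unitary V"
    and A: "A = U ** diag_op a ** adj U" and B: "B = V ** diag_op b ** adj V"
    and a: "\<And>i. 0 \<le> a i" and b: "\<And>i. 0 \<le> b i"
begin

text \<open>In the eigenbases the minimization over \<open>z\<close> decouples into one scalar
  problem per matrix entry.\<close>

lemma split_form_diag:
  "split_form y A B l z = (\<Sum>i\<in>UNIV. \<Sum>j\<in>UNIV.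
      a i * (cmod ((adj U ** z ** V) $ i $ j))\<^sup>2 +
      l * b j * (cmod ((adj U ** y ** V) $ i $ j - (adj U ** z ** V) $ i $ j))\<^sup>2)"
proof -
  \<comment> \<open>The missing factor is the identity, diagonalized in the other basis, so that
    \<open>trace_diag_form\<close> applies to both traces.\<close>
  have "trace (adj z ** A ** z) = trace (adj z ** (U ** diag_op a ** adj U) ** z ** (V ** diag_op (\<lambda>i. 1) ** adj V))"
    by (simp add: A unitary_conj_one[OF V])
  moreover have "trace (adj (y - z) ** (y - z) ** B)
      = trace (adj (y - z) ** (U ** diag_op (\<lambda>i. 1) ** adj U) ** (y - z) ** (V ** diag_op b ** adj V))"
    by (simp add: B unitary_conj_one[OF U])
  ultimately show ?thesis
    unfolding split_form_def trace_diag_form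
    by (simp add: matrix_mul_diff_left matrix_mul_diff_right sum.distrib sum_distrib_left mult_ac)
qed

text \<open>Each entry is minimized separately, so the infimum is attained and is a sum of scalar
  parallel sums. The last two facts are free of the chosen eigenbases and get restated for positive
  operators below.\<close>

lemma parallel_form_diag:
  assumes l: "0 < l"
  shows "parallel_form y A B l = (\<Sum>i\<in>UNIV. \<Sum>j\<in>UNIV.
      a i * (l * b j) / (a i + l * b j) * (cmod ((adj U ** y ** V) $ i $ j))\<^sup>2)" (is "_ = ?Q")
    and "\<exists>z. split_form y A B l z = parallel_form y A B l"
    and "parallel_form y A B l \<le> split_form y A B l z"
proof -
  have le: "?Q \<le> split_form y A B l z" for z
    unfolding split_form_diag using l by (intro sum_mono parallel_sum_le) (simp_all add: a b)
  \<comment> \<open>The scalar minimizers in the eigenbasis coordinates; \<open>z\<close> rotates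
    them back.\<close>
  define z' where "z' = (\<chi> i j. complex_of_real (l * b j / (a i + l * b j)) * (adj U ** y ** V) $ i $ j)"
  define z where "z = U ** z' ** adj V"
  have "adj U ** z ** V = (adj U ** U) ** z' ** (adj V ** V)"
    by (simp add: z_def matrix_mul_assoc)
  then have z: "(adj U ** z ** V) $ i $ j
      = complex_of_real (l * b j / (a i + l * b j)) * (adj U ** y ** V) $ i $ j" for i j
    using U V by (simp add: unitaryD z'_def)
  have eq: "split_form y A B l z = ?Q"
    unfolding split_form_diag z using l by (intro sum.cong refl parallel_sum_eq) (simp_all add: a b)
  have "?Q \<in> range (split_form y A B l)"
    using eq by (metis rangeI)
  then have "parallel_form y A B l = ?Q"
    unfolding parallel_form_def using le by (intro cInf_eq_minimum) auto
  then show "parallel_form y A B l = ?Q" "\<exists>z. split_form y A B l z = parallel_form y A B l"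
      "parallel_form y A B l \<le> split_form y A B l z" for z
    using le eq by auto
qed

end

lemma
  assumes A: "positive_op A" and B: "positive_op B" and l: "0 < l"
  shows parallel_form_attained: "\<exists>z. split_form y A B l z = parallel_form y A B l"
    and parallel_form_le: "parallel_form y A B l \<le> split_form y A B l z"
proof -
  obtain U a where U: "unitary U" "A = U ** diag_op a ** adj U" and a: "\<And>i. 0 \<le> a i"
    using positive_op_diagonalization[OF A] by blast
  obtain V b where V: "unitary V" "B = V ** diag_op b ** adj V" and b: "\<And>i. 0 \<le> b i"
    using positive_op_diagonalization[OF B] by blast
  note diag = parallel_form_diag[OF U(1) V(1) U(2) V(2) a b l]
  show "\<exists>z. split_form y A B l z = parallel_form y A B l" by (rule diag(2))
  show "parallel_form y A B l \<le> split_form y A B l z" by (rule diag(3))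
qed

lemma split_form_sum:
  "split_form y (\<Sum>i\<in>I. p i *\<^sub>R A i) (\<Sum>i\<in>I. p i *\<^sub>R B i) l z = (\<Sum>i\<in>I. p i * split_form y (A i) (B i) l z)"
  by (simp add: split_form_def matrix_mul_sum_left matrix_mul_sum_right matrix_mul_scaleR_left
      matrix_mul_scaleR_right trace_sum trace_scaleR sum_distrib_left sum.distrib distrib_left mult_ac)

text \<open>The minimizer \<open>z\<close> of the averaged problem is a competitor in each
  individual one, and for fixed \<open>z\<close> the cost is linear in the pair of
  operators.\<close>

lemma parallel_form_concave:
  assumes "finite I" and p: "\<And>i. i \<in> I \<Longrightarrow> 0 \<le> p i"
    and A: "\<And>i. i \<in> I \<Longrightarrow> positive_op (A i)" and B: "\<And>i. i \<in> I \<Longrightarrow> positive_op (B i)" and l: "0 < l"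
  shows "(\<Sum>i\<in>I. p i * parallel_form y (A i) (B i) l)
    \<le> parallel_form y (\<Sum>i\<in>I. p i *\<^sub>R A i) (\<Sum>i\<in>I. p i *\<^sub>R B i) l"
proof -
  have "positive_op (\<Sum>i\<in>I. p i *\<^sub>R A i)" "positive_op (\<Sum>i\<in>I. p i *\<^sub>R B i)"
    using A B p by (auto intro: positive_op_sum)
  then obtain z where z: "split_form y (\<Sum>i\<in>I. p i *\<^sub>R A i) (\<Sum>i\<in>I. p i *\<^sub>R B i) l z
      = parallel_form y (\<Sum>i\<in>I. p i *\<^sub>R A i) (\<Sum>i\<in>I. p i *\<^sub>R B i) l"
    using parallel_form_attained l by blast
  have "(\<Sum>i\<in>I. p i * parallel_form y (A i) (B i) l) \<le> (\<Sum>i\<in>I. p i * split_form y (A i) (B i) l z)"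
    using p A B l by (intro sum_mono mult_left_mono parallel_form_le)
  then show ?thesis
    by (simp add: z[symmetric] split_form_sum)
qed

section \<open>Integral representation of the powers and concavity\<close>

definition stieltjes_const :: "real \<Rightarrow> ennreal" where
  "stieltjes_const s = (\<integral>\<^sup>+l. ennreal (indicator {0<..} l * (l powr (s - 1) / (1 + l))) \<partial>lborel)"

text \<open>On \<open>{1..2}\<close> the integrand is at least \<open>1 / 6\<close>. The value for
  \<open>0 < s < 1\<close> is \<open>pi / sin (pi * s)\<close>, but the constant is only cancelled
  later, so it suffices that it is neither zero nor infinite.\<close>

lemma stieltjes_const_pos:
  assumes "0 < s"
  shows "stieltjes_const s \<noteq> 0"
proof -
  have "ennreal (1 / 6) = (\<integral>\<^sup>+l. ennreal (1 / 6) * indicator {1..2::real} l \<partial>lborel)"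
    by (subst nn_integral_cmult_indicator) simp_all
  also have "\<dots> \<le> stieltjes_const s"
    unfolding stieltjes_const_def
  proof (rule nn_integral_mono)
    fix l :: real
    show "ennreal (1 / 6) * indicator {1..2} l \<le> ennreal (indicator {0<..} l * (l powr (s - 1) / (1 + l)))"
    proof (cases "l \<in> {1..2}")
      case True
      then have "1 / 2 \<le> l powr (-1)" by (simp add: powr_minus_divide field_simps)
      also have "\<dots> \<le> l powr (s - 1)" using True assms by (intro powr_mono) auto
      finally have "(1 / 2) / 3 \<le> l powr (s - 1) / (1 + l)"
        using True by (intro frac_le) auto
      with True show ?thesis by (auto intro: ennreal_leI)
    qed simp
  qed
  finally show ?thesis by (auto simp: ennreal_eq_0_iff)
qed

text \<open>Near zero the integrand is dominated by \<open>l powr (s - 1)\<close>, integrable as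
  \<open>0 < s\<close>; beyond one by \<open>l powr (s - 2)\<close>, integrable as
  \<open>s < 1\<close>.\<close>

lemma stieltjes_const_finite:
  assumes "0 < s" "s < 1"
  shows "stieltjes_const s \<noteq> \<infinity>"
proof -
  have "stieltjes_const s \<le> (\<integral>\<^sup>+l. ennreal (l powr (s - 1)) * indicator {0..1} l
      + ennreal (l powr (s - 2)) * indicator {1..} l \<partial>lborel)"
    unfolding stieltjes_const_def
  proof (rule nn_integral_mono)
    fix l :: real
    consider "l \<le> 0" | "0 < l" "l \<le> 1" | "1 < l" by linarith
    then show "ennreal (indicator {0<..} l * (l powr (s - 1) / (1 + l)))
        \<le> ennreal (l powr (s - 1)) * indicator {0..1} l + ennreal (l powr (s - 2)) * indicator {1..} l"
    proof cases
      case 2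
      then have "l powr (s - 1) / (1 + l) \<le> l powr (s - 1)"
        by (simp add: divide_le_eq_1 mult_le_cancel_left1 field_simps)
      then have "ennreal (l powr (s - 1) / (1 + l)) \<le> ennreal (l powr (s - 1))" by (rule ennreal_leI)
      then show ?thesis using 2 by (auto intro: add_increasing2)
    next
      case 3
      have "l powr (s - 1) = l powr (s - 2) * l"
        using 3 powr_add[of l "s - 2" 1] by simp
      then have "l powr (s - 1) / (1 + l) \<le> l powr (s - 2)"
        using 3 by (simp add: field_simps)
      then show ?thesis using 3 by (auto intro: ennreal_leI)
    qed auto
  qed
  also have "\<dots> = ennreal (1 / s) + ennreal (1 / (1 - s))"
  proof (subst nn_integral_add)
    have "(\<integral>\<^sup>+l. ennreal (l powr (s - 1)) * indicator {0..1} l \<partial>lborel) = ennreal (1 / s)"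
      using has_integral_powr_from_0[of "s - 1" 1] assms
      by (intro nn_integral_has_integral_lebesgue') auto
    moreover have "(\<integral>\<^sup>+l. ennreal (l powr (s - 2)) * indicator {1..} l \<partial>lborel) = ennreal (1 / (1 - s))"
      using has_integral_powr_to_inf[of "s - 2" 1] assms
      by (intro nn_integral_has_integral_lebesgue') (auto simp: minus_divide_right)
    ultimately show "(\<integral>\<^sup>+l. ennreal (l powr (s - 1)) * indicator {0..1} l \<partial>lborel)
        + (\<integral>\<^sup>+l. ennreal (l powr (s - 2)) * indicator {1..} l \<partial>lborel) = ennreal (1 / s) + ennreal (1 / (1 - s))"
      by simp
  qed simp_all
  also have "\<dots> < \<infinity>" by simp
  finally show ?thesis by simp
qed

text \<open>Substituting \<open>l = (a / b) x\<close> extracts the factor \<open>a\<^sup>s b\<^sup>1\<^sup>-\<^sup>s\<close>.\<close>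

lemma parallel_sum_integral:
  assumes "0 < s" "s < 1" and ab: "0 \<le> a" "0 \<le> b"
  shows "(\<integral>\<^sup>+l. ennreal (indicator {0<..} l * l powr (s - 2) * (a * (l * b) / (a + l * b))) \<partial>lborel)
    = ennreal (a powr s * b powr (1 - s)) * stieltjes_const s"
proof (cases "a = 0 \<or> b = 0")
  case True
  then show ?thesis by auto
next
  case False
  then have a: "0 < a" and b: "0 < b" using ab by auto
  define c where "c = a / b"
  have c: "0 < c" using a b by (simp add: c_def)
  let ?f = "\<lambda>l. ennreal (indicator {0<..} l * l powr (s - 2) * (a * (l * b) / (a + l * b)))"
  have "(\<integral>\<^sup>+l. ?f l \<partial>lborel) = ennreal \<bar>c\<bar> * (\<integral>\<^sup>+l. ?f (0 + c * l) \<partial>lborel)"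
    using c by (intro nn_integral_real_affine) auto
  also have "\<dots> = (\<integral>\<^sup>+l. ennreal c * ?f (c * l) \<partial>lborel)"
    using c by (subst nn_integral_cmult) auto
  also have "\<dots> = (\<integral>\<^sup>+l. ennreal (a powr s * b powr (1 - s))
      * ennreal (indicator {0<..} l * (l powr (s - 1) / (1 + l))) \<partial>lborel)"
  proof (rule nn_integral_cong)
    fix l :: real
    show "ennreal c * ?f (c * l) = ennreal (a powr s * b powr (1 - s))
      * ennreal (indicator {0<..} l * (l powr (s - 1) / (1 + l)))"
    proof (cases "0 < l")
      case True
      have "a * (c * l * b) / (a + c * l * b) = a * l / (1 + l)"
      proof -
        have "a * (c * l * b) / (a + c * l * b) = (a * (a * l)) / (a * (1 + l))"
          using b by (simp add: c_def algebra_simps)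
        then show ?thesis using a by simp
      qed
      moreover have "(c * l) powr (s - 2) = c powr (s - 2) * l powr (s - 2)"
        using c True by (simp add: powr_mult)
      ultimately have "c * ((c * l) powr (s - 2) * (a * (c * l * b) / (a + c * l * b)))
          = (c * c powr (s - 2)) * a * ((l * l powr (s - 2)) / (1 + l))"
        by simp
      also have "c * c powr (s - 2) = c powr (s - 1)"
        using c powr_add[of c 1 "s - 2"] by simp
      also have "l * l powr (s - 2) = l powr (s - 1)"
        using True powr_add[of l 1 "s - 2"] by simp
      also have "c powr (s - 1) * a = a powr s * b powr (1 - s)"
        using a b powr_add[of a "s - 1" 1] powr_minus_divide[of b "1 - s"]
        by (simp add: c_def powr_divide)
      finally show ?thesis
        using True c by (simp add: ennreal_mult'[symmetric] zero_less_mult_iff)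
    next
      case False
      then show ?thesis using c by (simp add: zero_less_mult_iff)
    qed
  qed
  also have "\<dots> = ennreal (a powr s * b powr (1 - s)) * stieltjes_const s"
    unfolding stieltjes_const_def by (subst nn_integral_cmult) auto
  finally show ?thesis .
qed

text \<open>One summand of \<open>weighted_form\<close> on the diagonal, as a real number; for
  positive operators the trace is real by \<open>trace_power_form\<close>.\<close>

definition power_form ::
    "complex ^ 'n ^ 'n \<Rightarrow> real \<Rightarrow> complex ^ 'n ^ 'n \<Rightarrow> complex ^ 'n ^ 'n \<Rightarrow> real" where
  "power_form y s A B = Re (trace (adj y ** op_powr A s ** y ** op_powr B (1 - s)))"

lemma op_powr_diag:
  assumes "unitary U" "A = U ** diag_op d ** adj U"
  shows "op_powr A s = U ** diag_op (\<lambda>i. if s = 0 then 1 else d i powr s) ** adj U"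
  unfolding op_powr_def by (rule fun_calc_eq[OF assms])

lemma op_powr_0: "positive_op A \<Longrightarrow> op_powr A 0 = mat 1"
  by (rule positive_op_diagonalization[of A]) (simp_all add: op_powr_diag unitary_conj_one)

lemma op_powr_1:
  assumes "positive_op A"
  shows "op_powr A 1 = A"
proof -
  obtain U d where "unitary U" and A: "A = U ** diag_op d ** adj U" and "\<And>i. 0 \<le> d i"
    using positive_op_diagonalization[OF assms] by blast
  then show ?thesis by (subst op_powr_diag) auto
qed

text \<open>The scalar integral, summed over all pairs of eigenvalues with the squared entries of
  \<open>y\<close> as coefficients. The other facts are the side conditions for comparing such
  integrals.\<close>

lemma power_form_integral:
  assumes A: "positive_op A" and B: "positive_op B" and s: "0 < s" "s < 1"
  shows "(\<integral>\<^sup>+l. ennreal (indicator {0<..} l * l powr (s - 2) * parallel_form y A B l) \<partial>lborel)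
      = ennreal (power_form y s A B) * stieltjes_const s" (is ?integral)
    and "(\<lambda>l. indicator {0<..} l * l powr (s - 2) * parallel_form y A B l) \<in> borel_measurable borel" (is ?meas)
    and "0 < l \<Longrightarrow> 0 \<le> parallel_form y A B l"
    and "0 \<le> power_form y s A B"
proof -
  obtain U a where U: "unitary U" "A = U ** diag_op a ** adj U" and a: "\<And>i. 0 \<le> a i"
    using positive_op_diagonalization[OF A] by blast
  obtain V b where V: "unitary V" "B = V ** diag_op b ** adj V" and b: "\<And>i. 0 \<le> b i"
    using positive_op_diagonalization[OF B] by blast
  define c where "c i j = (cmod ((adj U ** y ** V) $ i $ j))\<^sup>2" for i j
  have c: "0 \<le> c i j" for i j by (simp add: c_def)
  define q where "q i j l = indicator {0<..} l * l powr (s - 2) * (a i * (l * b j) / (a i + l * b j))" for i j and l :: real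
  have q: "0 \<le> q i j l" for i j l
    using a b by (simp add: q_def indicator_def)
  have [measurable]: "q i j \<in> borel_measurable borel" for i j
    unfolding q_def by measurable
  have par: "parallel_form y A B l = (\<Sum>i\<in>UNIV. \<Sum>j\<in>UNIV. a i * (l * b j) / (a i + l * b j) * c i j)"
    if "0 < l" for l
    unfolding c_def by (rule parallel_form_diag(1)[OF U(1) V(1) U(2) V(2) a b that])
  have eq: "indicator {0<..} l * l powr (s - 2) * parallel_form y A B l
      = (\<Sum>i\<in>UNIV. \<Sum>j\<in>UNIV. q i j l * c i j)" for l
    by (cases "0 < l") (simp_all add: par q_def sum_distrib_left mult.assoc)
  show ?meas unfolding eq by measurable
  show "0 \<le> parallel_form y A B l" if "0 < l" for l
    unfolding par[OF that] using a b c that by (intro sum_nonneg) simp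
  have pow: "power_form y s A B = (\<Sum>i\<in>UNIV. \<Sum>j\<in>UNIV. a i powr s * b j powr (1 - s) * c i j)"
    unfolding power_form_def op_powr_diag[OF U] op_powr_diag[OF V] trace_diag_form c_def using s by simp
  show "0 \<le> power_form y s A B"
    unfolding pow using c by (intro sum_nonneg) simp
  have "(\<integral>\<^sup>+l. ennreal (\<Sum>i\<in>UNIV. \<Sum>j\<in>UNIV. q i j l * c i j) \<partial>lborel)
      = (\<integral>\<^sup>+l. (\<Sum>i\<in>UNIV. \<Sum>j\<in>UNIV. ennreal (q i j l) * ennreal (c i j)) \<partial>lborel)"
    using q c by (simp add: ennreal_mult sum_nonneg flip: sum_ennreal)
  also have "\<dots> = (\<Sum>i\<in>UNIV. \<Sum>j\<in>UNIV. (\<integral>\<^sup>+l. ennreal (q i j l) \<partial>lborel) * ennreal (c i j))"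
    by (simp add: nn_integral_sum nn_integral_multc)
  also have "\<dots> = (\<Sum>i\<in>UNIV. \<Sum>j\<in>UNIV. ennreal (a i powr s * b j powr (1 - s) * c i j)) * stieltjes_const s"
    unfolding q_def parallel_sum_integral[OF s a b]
    using c by (simp add: sum_distrib_left ennreal_mult mult_ac)
  also have "\<dots> = ennreal (power_form y s A B) * stieltjes_const s"
    unfolding pow using c by (simp add: sum_nonneg flip: sum_ennreal)
  finally show ?integral unfolding eq .
qed

text \<open>For \<open>0 < s < 1\<close>, integrate the concavity of the parallel forms against the
  weight \<open>l powr (s - 2)\<close> and cancel the constant. At the endpoints the integral
  diverges, but there the form is linear in one operator and independent of the other.\<close>

theorem lieb_concavity:
  assumes I: "finite I" and p: "\<And>i. i \<in> I \<Longrightarrow> 0 \<le> p i" "sum p I = 1"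
    and A: "\<And>i. i \<in> I \<Longrightarrow> positive_op (A i)" and B: "\<And>i. i \<in> I \<Longrightarrow> positive_op (B i)"
    and s: "s \<in> {0..1}"
  shows "(\<Sum>i\<in>I. p i * power_form y s (A i) (B i))
    \<le> power_form y s (\<Sum>i\<in>I. p i *\<^sub>R A i) (\<Sum>i\<in>I. p i *\<^sub>R B i)" (is "_ \<le> power_form y s ?A ?B")
proof -
  have AB: "positive_op ?A" "positive_op ?B"
    using A B p by (auto intro: positive_op_sum)
  consider "s = 0" | "s = 1" | "0 < s" "s < 1" using s by force
  then show ?thesis
  proof cases
    case 1
    \<comment> \<open>The zeroth power is the identity even for singular \<open>A i\<close>, so
      equality holds here.\<close>
    have "(\<Sum>i\<in>I. p i * power_form y s (A i) (B i)) = (\<Sum>i\<in>I. p i * Re (trace (adj y ** y ** B i)))"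
      using 1 A B by (intro sum.cong) (simp_all add: power_form_def op_powr_0 op_powr_1)
    also have "\<dots> = power_form y s ?A ?B"
      using 1 AB by (simp add: power_form_def op_powr_0 op_powr_1 matrix_mul_sum_right
          matrix_mul_scaleR_right trace_sum trace_scaleR)
    finally show ?thesis by simp
  next
    case 2
    have "(\<Sum>i\<in>I. p i * power_form y s (A i) (B i)) = (\<Sum>i\<in>I. p i * Re (trace (adj y ** A i ** y)))"
      using 2 A B by (intro sum.cong) (simp_all add: power_form_def op_powr_0 op_powr_1)
    also have "\<dots> = power_form y s ?A ?B"
      using 2 AB by (simp add: power_form_def op_powr_0 op_powr_1 matrix_mul_sum_right
          matrix_mul_sum_left matrix_mul_scaleR_left matrix_mul_scaleR_right trace_sum trace_scaleR)
    finally show ?thesis by simp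
  next
    case 3
    let ?w = "\<lambda>l. indicator {0<..} l * l powr (s - 2)"
    note int = power_form_integral(1)[OF _ _ 3] and meas = power_form_integral(2)[OF _ _ 3]
      and nonneg = power_form_integral(4)[OF _ _ 3] and par = power_form_integral(3)[OF _ _ 3]
    have "ennreal (\<Sum>i\<in>I. p i * power_form y s (A i) (B i)) * stieltjes_const s
        = (\<Sum>i\<in>I. ennreal (p i) * (ennreal (power_form y s (A i) (B i)) * stieltjes_const s))"
      using p nonneg[OF A B] by (subst sum_ennreal[symmetric])
        (auto simp: sum_distrib_left ennreal_mult mult_ac intro!: sum.cong)
    also have "\<dots> = (\<Sum>i\<in>I. ennreal (p i) * (\<integral>\<^sup>+l. ennreal (?w l * parallel_form y (A i) (B i) l) \<partial>lborel))"
      by (intro sum.cong refl) (simp add: int A B)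
    also have "\<dots> = (\<integral>\<^sup>+l. (\<Sum>i\<in>I. ennreal (p i) * ennreal (?w l * parallel_form y (A i) (B i) l)) \<partial>lborel)"
      using meas[OF A B] by (subst nn_integral_sum) (auto simp: nn_integral_cmult intro!: sum.cong)
    also have "\<dots> \<le> (\<integral>\<^sup>+l. ennreal (?w l * parallel_form y ?A ?B l) \<partial>lborel)"
    proof (rule nn_integral_mono)
      fix l :: real
      show "(\<Sum>i\<in>I. ennreal (p i) * ennreal (?w l * parallel_form y (A i) (B i) l))
          \<le> ennreal (?w l * parallel_form y ?A ?B l)"
      proof (cases "0 < l")
        case True
        have "(\<Sum>i\<in>I. ennreal (p i) * ennreal (?w l * parallel_form y (A i) (B i) l))
            = (\<Sum>i\<in>I. ennreal (p i * (?w l * parallel_form y (A i) (B i) l)))"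
          using p by (intro sum.cong) (simp_all add: ennreal_mult')
        also have "\<dots> = ennreal (\<Sum>i\<in>I. p i * (?w l * parallel_form y (A i) (B i) l))"
          using p par[OF A B True] by (intro sum_ennreal) simp
        also have "(\<Sum>i\<in>I. p i * (?w l * parallel_form y (A i) (B i) l))
            = ?w l * (\<Sum>i\<in>I. p i * parallel_form y (A i) (B i) l)"
          by (simp add: sum_distrib_left mult_ac)
        also have "ennreal \<dots> \<le> ennreal (?w l * parallel_form y ?A ?B l)"
          using parallel_form_concave[OF I p(1) A B True]
          by (intro ennreal_leI mult_left_mono) (simp_all add: indicator_def)
        finally show ?thesis .
      qed simp
    qed
    also have "\<dots> = ennreal (power_form y s ?A ?B) * stieltjes_const s"
      by (rule int[OF AB])
    finally have "stieltjes_const s * ennreal (\<Sum>i\<in>I. p i * power_form y s (A i) (B i))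
        \<le> stieltjes_const s * ennreal (power_form y s ?A ?B)"
      by (simp add: mult.commute)
    then have "ennreal (\<Sum>i\<in>I. p i * power_form y s (A i) (B i)) \<le> ennreal (power_form y s ?A ?B)"
      using stieltjes_const_pos[OF 3(1)] stieltjes_const_finite[OF 3]
      by (subst (asm) ennreal_mult_le_mult_iff) auto
    then show ?thesis
      using nonneg[OF AB] by (simp add: ennreal_le_iff)
  qed
qed

section \<open>Hilbert-Schmidt and Schatten norms\<close>

definition hs_sq :: "complex ^ 'n ^ 'n \<Rightarrow> real" where
  "hs_sq x = (\<Sum>i\<in>UNIV. \<Sum>j\<in>UNIV. (cmod (x $ i $ j))\<^sup>2)"

lemma hs_sq_nonneg: "0 \<le> hs_sq x"
  by (simp add: hs_sq_def sum_nonneg)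

lemma hs_sq_eq_0_iff: "hs_sq x = 0 \<longleftrightarrow> x = 0"
  by (auto simp: hs_sq_def sum_nonneg sum_nonneg_eq_0_iff vec_eq_iff)

lemma trace_adj_mult_self: "trace (adj x ** x) = complex_of_real (hs_sq x)"
  unfolding trace_adj_mult hs_sq_def
  by (subst sum.swap) (simp add: complex_norm_square mult.commute del: of_real_power)

lemma trace_unitary_conj:
  assumes "unitary U"
  shows "trace (U ** A ** adj U) = trace A"
proof -
  have "trace (U ** A ** adj U) = trace (adj U ** (U ** A))"
    by (rule trace_mul_sym)
  also have "adj U ** (U ** A) = A"
    using assms by (simp add: matrix_mul_assoc unitaryD)
  finally show ?thesis .
qed

lemma hs_sq_unitary_conj:
  assumes "unitary U"
  shows "hs_sq (U ** x ** adj U) = hs_sq x"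
proof -
  have "adj (U ** x ** adj U) ** (U ** x ** adj U) = U ** (adj x ** (adj U ** U) ** x) ** adj U"
    by (simp add: adj_mult adj_adj matrix_mul_assoc)
  then have "complex_of_real (hs_sq (U ** x ** adj U)) = complex_of_real (hs_sq x)"
    using assms by (simp add: unitaryD trace_unitary_conj flip: trace_adj_mult_self)
  then show ?thesis by simp
qed

lemma hs_sq_entry_le: "(cmod (x $ i $ j))\<^sup>2 \<le> hs_sq x"
proof -
  have "(cmod (x $ i $ j))\<^sup>2 \<le> (\<Sum>j\<in>UNIV. (cmod (x $ i $ j))\<^sup>2)"
    by (rule member_le_sum) auto
  also have "\<dots> \<le> hs_sq x"
    unfolding hs_sq_def by (rule member_le_sum) (auto intro: sum_nonneg)
  finally show ?thesis .
qed

text \<open>If \<open>U\<close> diagonalizes \<open>A\<close>, then \<open>adj V ** U\<close>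
  diagonalizes the conjugate with the same eigenvalues.\<close>

lemma fun_calc_conj:
  assumes V: "unitary V" and A: "adj A = A"
  shows "fun_calc \<phi> (adj V ** A ** V) = adj V ** fun_calc \<phi> A ** V"
proof -
  obtain U d where U: "unitary U" "A = U ** diag_op d ** adj U"
    using hermitian_diagonalization[OF A] .
  have "unitary (adj V ** U)"
    using U V by (simp add: unitary_mult unitary_adj)
  moreover have "adj V ** A ** V = (adj V ** U) ** diag_op d ** adj (adj V ** U)"
    by (simp add: U(2) adj_mult adj_adj matrix_mul_assoc)
  ultimately show ?thesis
    by (simp add: fun_calc_eq fun_calc_eq[OF U] adj_mult adj_adj matrix_mul_assoc)
qed

lemma op_powr_conj:
  "unitary V \<Longrightarrow> adj A = A \<Longrightarrow> op_powr (adj V ** A ** V) s = adj V ** op_powr A s ** V"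
  by (simp add: op_powr_def fun_calc_conj)

lemma hermitian_gram: "adj (adj A ** A) = adj A ** A"
  by (simp add: adj_mult adj_adj)

lemma positive_op_gram: "positive_op (adj A ** A)"
proof -
  have "positive_op (mat 1 :: complex ^ 'a ^ 'a)"
    unfolding positive_op_def
    by (auto intro!: sum_nonneg simp: less_eq_complex_def)
  from positive_op_conj[OF this, of A] show ?thesis by simp
qed

lemma abs_op_diag:
  assumes "unitary U" "adj A ** A = U ** diag_op d ** adj U"
  shows "abs_op A = U ** diag_op (\<lambda>i. sqrt (d i)) ** adj U"
  unfolding abs_op_def by (rule fun_calc_eq[OF assms])

lemma hermitian_abs_op: "adj (abs_op A) = abs_op A"
proof -
  obtain U d where "unitary U" "adj A ** A = U ** diag_op d ** adj U"
    using hermitian_diagonalization[OF hermitian_gram] .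
  then show ?thesis
    by (simp add: abs_op_diag adj_mult adj_adj adj_diag_op matrix_mul_assoc)
qed

lemma abs_op_conj:
  assumes "unitary V"
  shows "abs_op (adj V ** A ** V) = adj V ** abs_op A ** V"
proof -
  have "adj (adj V ** A ** V) ** (adj V ** A ** V) = adj V ** (adj A ** (V ** adj V) ** A) ** V"
    by (simp add: adj_mult adj_adj matrix_mul_assoc)
  then show ?thesis
    unfolding abs_op_def using assms
    by (simp add: unitaryD fun_calc_conj hermitian_gram)
qed

section \<open>Unitary invariance of Schatten norms and bounds on entries\<close>

lemma norm_unitary_mult_vec:
  fixes V :: "complex ^ 'n ^ 'n"
  assumes "unitary V"
  shows "norm (V *v x) = norm x"
proof -
  have sq: "complex_of_real ((norm y)\<^sup>2) = (\<Sum>i\<in>UNIV. cnj (y $ i) * y $ i)" for y :: "complex ^ 'n"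
    by (simp add: norm_vec_def L2_set_def sum_nonneg complex_norm_square mult.commute del: of_real_power)
  have "complex_of_real ((norm (V *v x))\<^sup>2) = complex_of_real ((norm x)\<^sup>2)"
    unfolding sq using assms
    by (simp add: sum_adj_mult_vec[symmetric] matrix_vector_mul_assoc unitaryD)
  then have "(norm (V *v x))\<^sup>2 = (norm x)\<^sup>2"
    using of_real_eq_iff by blast
  then show ?thesis by simp
qed

text \<open>For the operator norm, \<open>V\<close> is an isometry. Otherwise conjugation passes
  through the modulus and its powers, and the trace absorbs it. The inequality keeps unit balls
  stable under conjugation.\<close>

lemma schatten_norm_unitary_conj:
  fixes A :: "complex ^ 'n ^ 'n"
  assumes V: "unitary V"
  shows "schatten_norm p (adj V ** A ** V) \<le> schatten_norm p A"
proof (cases "p = \<infinity>")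
  case True
  have "norm ((adj V ** A ** V) *v x) \<le> onorm ((*v) A) * norm x" for x
  proof -
    have "norm ((adj V ** A ** V) *v x) = norm (A *v (V *v x))"
      using V by (simp add: matrix_vector_mul_assoc[symmetric] norm_unitary_mult_vec unitary_adj)
    also have "\<dots> \<le> onorm ((*v) A) * norm (V *v x)"
      by (rule onorm) simp
    finally show ?thesis using V by (simp add: norm_unitary_mult_vec)
  qed
  then show ?thesis using True by (simp add: schatten_norm_def onorm_le)
next
  case False
  have "trace (op_powr (abs_op (adj V ** A ** V)) q) = trace (op_powr (abs_op A) q)" for q
    using trace_unitary_conj[OF unitary_adj[OF V]] V
    by (simp add: abs_op_conj op_powr_conj hermitian_abs_op adj_adj)
  then show ?thesis using False by (simp add: schatten_norm_def)
qed

text \<open>A crude bound, uniform in \<open>p\<close>, that makes the supremum in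
  \<open>inf_schatten_norm\<close> finite. For finite \<open>p\<close> all singular values are at
  most one, hence the squared Hilbert-Schmidt norm is at most the dimension.\<close>

lemma schatten_norm_entry_le:
  fixes A :: "complex ^ 'n ^ 'n"
  assumes p: "1 \<le> p" and A: "schatten_norm p A \<le> 1"
  shows "cmod (A $ i $ j) \<le> real CARD('n)"
proof (cases "p = \<infinity>")
  case True
  have "A $ i $ j = (A *v axis j 1) $ i"
    by (simp add: matrix_vector_mult_def axis_def if_distrib[of "\<lambda>z. _ * z"] cong: if_cong)
  then have "cmod (A $ i $ j) \<le> norm (A *v axis j 1)"
    using Finite_Cartesian_Product.norm_nth_le[of "A *v axis j 1" i] by simp
  also have "\<dots> \<le> onorm ((*v) A) * norm (axis j (1::complex))"
    by (rule onorm) simp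
  also have "norm (axis j (1::complex)) = 1"
    by (simp add: norm_vec_def L2_set_def axis_def if_distrib[of norm] if_distrib[of "\<lambda>z. z\<^sup>2"] cong: if_cong)
  also have "onorm ((*v) A) * 1 \<le> 1"
    using A True by (simp add: schatten_norm_def)
  also have "\<dots> \<le> real CARD('n)"
    using zero_less_card_finite[where 'a = 'n] by linarith
  finally show ?thesis .
next
  case False
  define q where "q = enn2real p"
  have q: "1 \<le> q"
    using p False by (cases p) (auto simp: q_def)
  obtain U d where U: "unitary U" and eq: "adj A ** A = U ** diag_op d ** adj U" and d: "\<And>i. 0 \<le> d i"
    using positive_op_diagonalization[OF positive_op_gram] by blast
  have tr: "trace (U ** diag_op e ** adj U) = complex_of_real (sum e UNIV)" for e
    by (simp add: trace_unitary_conj[OF U]) (simp add: trace_def diag_op_def)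
  have "Re (trace (op_powr (abs_op A) q)) = (\<Sum>i\<in>UNIV. sqrt (d i) powr q)"
    using q by (simp add: op_powr_diag[OF U abs_op_diag[OF U eq]] tr del: of_real_sum)
  then have "(\<Sum>i\<in>UNIV. sqrt (d i) powr q) powr (1 / q) \<le> 1"
    using A False by (simp add: schatten_norm_def q_def)
  then have le: "(\<Sum>i\<in>UNIV. sqrt (d i) powr q) \<le> 1"
    using q by (smt (verit) gr_one_powr divide_pos_pos)
  have "d k \<le> 1" for k
  proof (rule ccontr)
    assume "\<not> d k \<le> 1"
    then have "1 < sqrt (d k) powr q"
      using q by (intro gr_one_powr) auto
    moreover have "sqrt (d k) powr q \<le> (\<Sum>i\<in>UNIV. sqrt (d i) powr q)"
      by (rule member_le_sum) auto
    ultimately show False using le by linarith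
  qed
  then have "sum d UNIV \<le> real CARD('n)"
    using sum_bounded_above[of UNIV d 1] by simp
  moreover have "complex_of_real (hs_sq A) = complex_of_real (sum d UNIV)"
    unfolding trace_adj_mult_self[symmetric] eq tr ..
  ultimately have "(cmod (A $ i $ j))\<^sup>2 \<le> real CARD('n)"
    using hs_sq_entry_le[of A i j] by (metis of_real_eq_iff order_trans)
  also have "\<dots> \<le> (real CARD('n))\<^sup>2"
    using zero_less_card_finite[where 'a = 'n] by (simp add: power2_eq_square)
  finally show ?thesis by (simp add: power2_le_iff_abs_le)
qed

text \<open>The equation gives \<open>1 / q \<le> 1\<close>; the value \<open>q = 0\<close> is
  excluded because \<open>1 / 0\<close> is infinite in \<open>ennreal\<close>.\<close>

lemma conjugate_exponent_ge_1:
  fixes p q :: ennreal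
  assumes "1 / p + 1 / q = 1"
  shows "1 \<le> q"
proof -
  have "1 / q \<le> 1" using assms by (metis add_increasing zero_le order_refl)
  show ?thesis
  proof (cases q)
    case (real r)
    show ?thesis
    proof (cases "r = 0")
      case False
      with real \<open>1 / q \<le> 1\<close> have "inverse r \<le> 1"
        by (simp add: divide_ennreal_def inverse_ennreal)
      with real False show ?thesis by (simp add: inverse_le_1_iff)
    qed (use real \<open>1 / q \<le> 1\<close> in \<open>simp add: divide_ennreal_def top_unique\<close>)
  qed simp
qed

section \<open>Weighted forms as Hilbert-Schmidt norms\<close>

lemma power_form_hs_sq:
  fixes A B :: "complex ^ 'n ^ 'n"
  assumes A: "positive_op A" and B: "positive_op B"
  obtains C D :: "complex ^ 'n ^ 'n" where
    "\<And>y. trace (adj y ** op_powr A s ** y ** op_powr B (1 - s)) = complex_of_real (hs_sq (C ** y ** D))"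
proof -
  obtain U a where U: "unitary U" "A = U ** diag_op a ** adj U" and a: "\<And>i. 0 \<le> a i"
    using positive_op_diagonalization[OF A] by blast
  obtain V b where V: "unitary V" "B = V ** diag_op b ** adj V" and b: "\<And>i. 0 \<le> b i"
    using positive_op_diagonalization[OF B] by blast
  define \<alpha> where "\<alpha> i = (if s = 0 then 1 else a i powr s)" for i
  define \<beta> where "\<beta> i = (if 1 - s = 0 then 1 else b i powr (1 - s))" for i
  \<comment> \<open>Up to outer unitaries, which do not affect the Hilbert-Schmidt norm, these are
    \<open>A\<close> to the power \<open>s / 2\<close> and \<open>B\<close> to the power
    \<open>(1 - s) / 2\<close>. They do not depend on \<open>y\<close>, so the entries of
    \<open>C ** y ** D\<close> are linear in \<open>y\<close>.\<close>
  define C where "C = diag_op (\<lambda>i. sqrt (\<alpha> i)) ** adj U"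
  define D where "D = V ** diag_op (\<lambda>i. sqrt (\<beta> i))"
  have nonneg: "0 \<le> \<alpha> i" "0 \<le> \<beta> i" for i
    by (simp_all add: \<alpha>_def \<beta>_def)
  have "C ** y ** D = diag_op (\<lambda>i. sqrt (\<alpha> i)) ** (adj U ** y ** V) ** diag_op (\<lambda>i. sqrt (\<beta> i))" for y
    by (simp add: C_def D_def matrix_mul_assoc)
  then have "hs_sq (C ** y ** D) = (\<Sum>i\<in>UNIV. \<Sum>j\<in>UNIV. \<alpha> i * \<beta> j * (cmod ((adj U ** y ** V) $ i $ j))\<^sup>2)" for y
    using nonneg
    by (simp add: hs_sq_def diag_op_mult_left diag_op_mult_right norm_mult power_mult_distrib mult_ac)
  moreover have "op_powr A s = U ** diag_op \<alpha> ** adj U" "op_powr B (1 - s) = V ** diag_op \<beta> ** adj V"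
    unfolding op_powr_diag[OF U] op_powr_diag[OF V] \<alpha>_def \<beta>_def by (rule refl)+
  ultimately show ?thesis
    by (intro that[of C D]) (simp only: trace_diag_form)
qed

lemma trace_power_form:
  assumes "positive_op A" "positive_op B"
  shows "trace (adj y ** op_powr A s ** y ** op_powr B (1 - s)) = complex_of_real (power_form y s A B)"
proof (rule power_form_hs_sq[OF assms, of s])
  fix C D
  assume "\<And>y. trace (adj y ** op_powr A s ** y ** op_powr B (1 - s)) = complex_of_real (hs_sq (C ** y ** D))"
  then show ?thesis by (simp add: power_form_def)
qed

lemma weighted_form_power_form:
  assumes "positive_op A" "positive_op B"
  shows "weighted_form S A B s x x = complex_of_real (\<Sum>g\<in>S. power_form (x g) s A B)"
  by (simp add: weighted_form_def trace_power_form[OF assms])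

text \<open>Cyclicity of the trace moves the unitaries from \<open>y\<close> onto the weights. With
  \<open>V = u h\<close> this turns an average over the orbit of \<open>y\<close> into an average
  over conjugated weights, ready for Lieb's theorem.\<close>

lemma power_form_unitary_conj:
  assumes V: "unitary V" and A: "positive_op A" and B: "positive_op B"
  shows "power_form (V ** y ** adj V) s A B = power_form y s (adj V ** A ** V) (adj V ** B ** V)"
proof -
  let ?A = "op_powr A s" and ?B = "op_powr B (1 - s)"
  have "trace (adj (V ** y ** adj V) ** ?A ** (V ** y ** adj V) ** ?B)
      = trace (V ** (adj y ** adj V ** ?A ** V ** y ** adj V ** ?B))"
    by (simp add: adj_mult adj_adj matrix_mul_assoc)
  also have "\<dots> = trace (adj y ** (adj V ** ?A ** V) ** y ** (adj V ** ?B ** V))"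
    by (subst trace_mul_sym) (simp add: matrix_mul_assoc)
  finally show ?thesis
    by (simp add: power_form_def op_powr_conj V positive_op_hermitian A B)
qed

lemma power_form_zero: "power_form 0 s A B = 0"
  by (simp add: power_form_def adj_def matrix_matrix_mult_def trace_def)

section \<open>Transference\<close>

lemma mat_mult_entry: "(mat c ** A) $ i $ j = c * A $ i $ j"
  by (simp add: mat_def matrix_matrix_mult_def if_distrib[of "\<lambda>z. z * _"] cong: if_cong)

lemma mult_mat_entry: "(A ** mat c) $ i $ j = A $ i $ j * c"
  by (simp add: mat_def matrix_matrix_mult_def if_distrib[of "\<lambda>z. _ * z"] cong: if_cong)

lemma Sup_insert_0_le:
  fixes X :: "real set"
  assumes "0 \<le> c" "\<And>x. x \<in> X \<Longrightarrow> x \<le> c"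
  shows "Sup (insert 0 X) \<le> c"
  using assms by (intro cSup_least) auto

lemma le_Sup_insert_0:
  fixes X :: "real set"
  assumes "bdd_above X" "x \<in> insert 0 X"
  shows "x \<le> Sup (insert 0 X)"
  using assms by (intro cSup_upper) auto

text \<open>A real \<open>Sup\<close> is informative only for bounded sets. The entry bound on
  \<open>A\<close> is uniform over the dual unit ball, and \<open>S\<close> is finite.\<close>

lemma bdd_above_inf_schatten_norm:
  fixes x :: "'a \<Rightarrow> complex ^ 'n ^ 'n"
  assumes "finite S"
  shows "bdd_above {cmod (trace (A ** x h)) | A h p'.
    1 / p + 1 / p' = 1 \<and> schatten_norm p' A \<le> 1 \<and> h \<in> S}"
proof (rule bdd_aboveI)
  define c where "c h = (\<Sum>i\<in>(UNIV::'n set). \<Sum>j\<in>UNIV. real CARD('n) * cmod (x h $ j $ i))" for h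
  fix r
  assume "r \<in> {cmod (trace (A ** x h)) | A h p'.
    1 / p + 1 / p' = 1 \<and> schatten_norm p' A \<le> 1 \<and> h \<in> S}"
  then obtain A h p' where r: "r = cmod (trace (A ** x h))" and p': "1 / p + 1 / p' = 1"
    and A: "schatten_norm p' A \<le> 1" and h: "h \<in> S"
    by blast
  have "r = cmod (\<Sum>i\<in>UNIV. \<Sum>j\<in>UNIV. A $ i $ j * x h $ j $ i)"
    by (simp add: r trace_def matrix_matrix_mult_def)
  also have "\<dots> \<le> (\<Sum>i\<in>UNIV. \<Sum>j\<in>UNIV. cmod (A $ i $ j * x h $ j $ i))"
    by (intro order_trans[OF norm_sum] sum_mono order_refl)
  also have "\<dots> \<le> c h"
    unfolding c_def norm_mult
    by (intro sum_mono mult_right_mono schatten_norm_entry_le[OF conjugate_exponent_ge_1[OF p'] A]) simp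
  also have "\<dots> \<le> (\<Sum>h\<in>S. c h)"
    using assms h by (intro member_le_sum) (auto simp: c_def intro!: sum_nonneg)
  finally show "r \<le> (\<Sum>h\<in>S. c h)" .
qed

section \<open>The orbit map and its intertwining relations\<close>

locale transference = group G
  for G :: "('a, 'm) monoid_scheme" (structure) +
  fixes k w :: "'a \<Rightarrow> real" and u :: "'a \<Rightarrow> complex ^ 'n ^ 'n" and S :: "'a set"
  assumes finite_carrier: "finite (carrier G)"
    and kernel: "markov_kernel G k"
    and rep: "projective_unitary_rep G u"
    and S_subset: "S \<subseteq> carrier G"
    and weight_nonneg: "g \<in> S \<Longrightarrow> 0 \<le> w g"
begin

definition prob :: "'a \<Rightarrow> real" where
  "prob g = k g / real (card (carrier G))"

definition orbit :: "complex ^ 'n ^ 'n \<Rightarrow> 'a \<Rightarrow> complex ^ 'n ^ 'n" where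
  "orbit x g = u g ** x ** adj (u g)"

abbreviation channel :: "complex ^ 'n ^ 'n \<Rightarrow> complex ^ 'n ^ 'n" where
  "channel \<equiv> transferred_channel G k u"

lemma finite_S: "finite S"
  using S_subset finite_carrier by (rule finite_subset)

lemma prob_nonneg: "g \<in> carrier G \<Longrightarrow> 0 \<le> prob g"
  using kernel by (simp add: prob_def markov_kernel_def)

lemma sum_prob: "sum prob (carrier G) = 1"
  using kernel by (simp add: prob_def markov_kernel_def sum_divide_distrib[symmetric])

text \<open>Substituting \<open>h \<otimes> g\<close> for \<open>g\<close> exhibits the Markov map
  as an average of right translations, with the same probabilities as in
  \<open>channel_eq\<close>.\<close>

lemma markov_map_eq:
  assumes h: "h \<in> carrier G"
  shows "markov_map G k f h = (\<Sum>g\<in>carrier G. prob g *\<^sub>R f (h \<otimes> g))"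
proof -
  have "(\<Sum>g\<in>carrier G. k (inv h \<otimes> g) *\<^sub>R f g) = (\<Sum>g\<in>carrier G. k g *\<^sub>R f (h \<otimes> g))"
    by (rule sum.reindex_bij_witness[where i = "\<lambda>g. h \<otimes> g" and j = "\<lambda>g. inv h \<otimes> g"])
      (use h in \<open>auto simp: m_assoc[symmetric]\<close>)
  then show ?thesis
    by (simp add: markov_map_def prob_def scaleR_sum_right)
qed

lemma channel_eq: "channel x = (\<Sum>g\<in>carrier G. prob g *\<^sub>R orbit x g)"
  by (simp add: transferred_channel_def prob_def orbit_def scaleR_sum_right)

lemma unitary_u: "g \<in> carrier G \<Longrightarrow> unitary (u g)"
  using rep by (simp add: projective_unitary_rep_def)

lemma orbit_sum: "orbit (\<Sum>i\<in>I. c i *\<^sub>R x i) g = (\<Sum>i\<in>I. c i *\<^sub>R orbit (x i) g)"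
  by (simp add: orbit_def matrix_mul_sum_left matrix_mul_sum_right matrix_mul_scaleR_left matrix_mul_scaleR_right)

lemma orbit_scaleR: "orbit (c *\<^sub>R x) g = c *\<^sub>R orbit x g"
  by (simp add: orbit_def matrix_mul_scaleR_left matrix_mul_scaleR_right)

lemma orbit_diff: "orbit (x - y) g = orbit x g - orbit y g"
  by (simp add: orbit_def matrix_mul_diff_left matrix_mul_diff_right)

text \<open>The phases of the projective representation cancel.\<close>

lemma orbit_orbit:
  assumes g: "g \<in> carrier G" and h: "h \<in> carrier G"
  shows "orbit (orbit x g) h = orbit x (h \<otimes> g)"
proof -
  obtain c where c: "cmod c = 1" and uu: "u h ** u g = mat c ** u (h \<otimes> g)"
    using rep g h unfolding projective_unitary_rep_def by metis
  have cc: "c * cnj c = 1"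
    using c by (metis complex_norm_square of_real_1 one_power2)
  have "orbit (orbit x g) h = (u h ** u g) ** x ** adj (u h ** u g)"
    by (simp add: orbit_def adj_mult matrix_mul_assoc)
  also have "\<dots> = mat c ** orbit x (h \<otimes> g) ** mat (cnj c)"
    by (simp add: uu orbit_def adj_mult adj_mat matrix_mul_assoc)
  also have "\<dots> = orbit x (h \<otimes> g)"
    using cc by (simp add: vec_eq_iff mult_mat_entry mat_mult_entry)
  finally show ?thesis .
qed

text \<open>In a projective representation \<open>u \<one>\<close> is only a phase. Conjugation by
  it is idempotent by \<open>orbit_orbit\<close> and injective, hence the identity.\<close>

lemma orbit_one: "orbit x \<one> = x"
proof -
  have "adj (u \<one>) ** orbit y \<one> ** u \<one> = y" for y
  proof -
    have "adj (u \<one>) ** orbit y \<one> ** u \<one> = (adj (u \<one>) ** u \<one>) ** y ** (adj (u \<one>) ** u \<one>)"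
      by (simp add: orbit_def matrix_mul_assoc)
    then show ?thesis using unitary_u[OF one_closed] by (simp add: unitaryD)
  qed
  moreover have "orbit (orbit x \<one>) \<one> = orbit x \<one>"
    using orbit_orbit[of \<one> \<one> x] by simp
  ultimately show ?thesis by metis
qed

lemma orbit_channel:
  assumes "h \<in> carrier G"
  shows "orbit (channel x) h = (\<Sum>g\<in>carrier G. prob g *\<^sub>R orbit x (h \<otimes> g))"
  using assms by (simp add: channel_eq orbit_sum orbit_orbit)

lemma orbit_op_grad:
  assumes "g \<in> carrier G" "h \<in> carrier G"
  shows "orbit (op_grad u w x g) h = sqrt (w g) *\<^sub>R (orbit x (h \<otimes> g) - orbit x h)"
  using orbit_orbit[OF assms] by (simp add: op_grad_def orbit_scaleR orbit_diff flip: orbit_def)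

text \<open>The hypotheses on the Markov map concern scalar functions, so the orbit map is composed
  with a linear functional: a matrix entry of \<open>C ** y ** D\<close> for the weighted forms,
  \<open>trace (A ** y)\<close> for the Schatten norms.\<close>

lemma markov_map_orbit:
  assumes "linear L" "h \<in> carrier G"
  shows "markov_map G k (\<lambda>h. L (orbit x h)) h = L (orbit (channel x) h)"
  using assms(2) by (simp add: markov_map_eq orbit_channel linear_sum[OF assms(1)] linear_scale[OF assms(1)])

lemma grad_orbit:
  assumes "linear L" "g \<in> carrier G" "h \<in> carrier G"
  shows "grad G w g (\<lambda>h. L (orbit x h)) h = L (orbit (op_grad u w x g) h)"
  using assms(2,3) by (simp add: grad_def orbit_op_grad linear_diff[OF assms(1)] linear_scale[OF assms(1)])

lemma grad_markov_map_orbit: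
  assumes "linear L" "g \<in> carrier G" "h \<in> carrier G"
  shows "grad G w g (markov_map G k (\<lambda>h. L (orbit x h))) h = L (orbit (op_grad u w (channel x) g) h)"
  using assms by (simp add: grad_orbit[symmetric] grad_def markov_map_orbit)

text \<open>Under the trace, conjugation by \<open>adj (u g)\<close> is adjoint to conjugation by
  \<open>u g\<close>. The adjoint channel is thus a convex combination of unitary conjugates, as
  Lieb's theorem requires.\<close>

lemma trace_adjoint_channel:
  "trace_adjoint channel y = (\<Sum>g\<in>carrier G. prob g *\<^sub>R (adj (u g) ** y ** u g))"
proof -
  have "trace (adj (orbit x g) ** y) = trace (adj x ** (adj (u g) ** y ** u g))" for x y g
  proof -
    have "trace (adj (orbit x g) ** y) = trace (u g ** (adj x ** adj (u g) ** y))"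
      by (simp add: orbit_def adj_mult adj_adj matrix_mul_assoc)
    also have "\<dots> = trace (adj x ** (adj (u g) ** y ** u g))"
      by (subst trace_mul_sym) (simp add: matrix_mul_assoc)
    finally show ?thesis .
  qed
  then have "trace_adjoint channel = (\<lambda>y. \<Sum>g\<in>carrier G. prob g *\<^sub>R (adj (u g) ** y ** u g))"
    by (intro trace_adjoint_eq) (simp add: channel_eq adj_sum adj_scaleR matrix_mul_sum_left
        matrix_mul_sum_right matrix_mul_scaleR_left matrix_mul_scaleR_right trace_sum trace_scaleR)
  then show ?thesis by simp
qed

section \<open>Gradient estimates for the weighted forms\<close>

context
  fixes \<kappa> :: real
  assumes gradient_estimate: "\<And>f h. h \<in> carrier G \<Longrightarrow>
    grad_sq G S w (markov_map G k f) h \<le> (1 - \<kappa>) * markov_map G k (grad_sq G S w f) h"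
begin

text \<open>The scalar estimate at the unit of \<open>G\<close>, applied to every entry of \<open>h \<mapsto> C u(h) x u(h)\<^sup>* D\<close>.\<close>

lemma hs_gradient_estimate:
  "(\<Sum>g\<in>S. hs_sq (C ** op_grad u w (channel x) g ** D))
    \<le> (1 - \<kappa>) * (\<Sum>h\<in>carrier G. prob h * (\<Sum>g\<in>S. hs_sq (C ** orbit (op_grad u w x g) h ** D)))"
proof -
  define L where "L i j y = (C ** y ** D) $ i $ j" for i j and y :: "complex ^ 'n ^ 'n"
  have L: "linear (L i j)" for i j
  proof (rule linearI)
    fix y z :: "complex ^ 'n ^ 'n" and r :: real
    have "C ** (y + z) ** D = C ** y ** D + C ** z ** D"
      by (simp add: matrix_add_ldistrib) (simp add: matrix_matrix_mult_def vec_eq_iff distrib_right sum.distrib)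
    then show "L i j (y + z) = L i j y + L i j z" by (simp add: L_def)
    show "L i j (r *\<^sub>R y) = r *\<^sub>R L i j y"
      by (simp add: L_def matrix_mul_scaleR_left matrix_mul_scaleR_right)
  qed
  have hs: "hs_sq (C ** y ** D) = (\<Sum>i\<in>UNIV. \<Sum>j\<in>UNIV. (cmod (L i j y))\<^sup>2)" for y
    by (simp add: hs_sq_def L_def)
  have hs_sum: "(\<Sum>g\<in>S. hs_sq (C ** z g ** D)) = (\<Sum>i\<in>UNIV. \<Sum>j\<in>UNIV. \<Sum>g\<in>S. (cmod (L i j (z g)))\<^sup>2)"
    for z
    unfolding hs by (simp add: sum.swap[of _ _ S])
  have S: "g \<in> carrier G" if "g \<in> S" for g using that S_subset by blast
  have entry: "(\<Sum>g\<in>S. (cmod (L i j (op_grad u w (channel x) g)))\<^sup>2)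
      \<le> (1 - \<kappa>) * (\<Sum>h\<in>carrier G. prob h * (\<Sum>g\<in>S. (cmod (L i j (orbit (op_grad u w x g) h)))\<^sup>2))" for i j
    using gradient_estimate[of \<one> "\<lambda>h. L i j (orbit x h)"] L
    by (simp add: grad_sq_def markov_map_eq[of \<one> "grad_sq G S w _"] grad_markov_map_orbit grad_orbit S orbit_one)
  have "(\<Sum>g\<in>S. hs_sq (C ** op_grad u w (channel x) g ** D))
      = (\<Sum>i\<in>UNIV. \<Sum>j\<in>UNIV. \<Sum>g\<in>S. (cmod (L i j (op_grad u w (channel x) g)))\<^sup>2)"
    by (rule hs_sum)
  also have "\<dots> \<le> (\<Sum>i\<in>UNIV. \<Sum>j\<in>UNIV. (1 - \<kappa>)
      * (\<Sum>h\<in>carrier G. prob h * (\<Sum>g\<in>S. (cmod (L i j (orbit (op_grad u w x g) h)))\<^sup>2)))"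
    by (intro sum_mono entry)
  also have "\<dots> = (1 - \<kappa>) * (\<Sum>h\<in>carrier G. prob h * (\<Sum>g\<in>S. hs_sq (C ** orbit (op_grad u w x g) h ** D)))"
    unfolding hs_sum by (simp add: sum_distrib_left sum.swap[of _ "carrier G"])
  finally show ?thesis .
qed

text \<open>For \<open>C = D = mat 1\<close>, unitary invariance turns the averaged right hand side
  into \<open>(1 - \<kappa>) * c\<close>, where \<open>c\<close> is the total squared norm of the
  gradient. The left hand side is nonnegative, so a negative factor forces
  \<open>c = 0\<close>.\<close>

lemma op_grad_eq_0:
  assumes "1 < \<kappa>" "g \<in> S"
  shows "op_grad u w x g = 0"
proof -
  define c where "c = (\<Sum>g\<in>S. hs_sq (op_grad u w x g))"
  have "(\<Sum>g\<in>S. hs_sq (op_grad u w (channel x) g))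
      \<le> (1 - \<kappa>) * (\<Sum>h\<in>carrier G. prob h * (\<Sum>g\<in>S. hs_sq (orbit (op_grad u w x g) h)))"
    using hs_gradient_estimate[of "mat 1" x "mat 1"] by simp
  also have "(\<Sum>h\<in>carrier G. prob h * (\<Sum>g\<in>S. hs_sq (orbit (op_grad u w x g) h)))
      = (\<Sum>h\<in>carrier G. prob h * c)"
    by (intro sum.cong) (simp_all add: c_def orbit_def hs_sq_unitary_conj unitary_u)
  also have "\<dots> = c"
    by (simp add: sum_prob flip: sum_distrib_right)
  finally have "0 \<le> (1 - \<kappa>) * c"
    by (meson hs_sq_nonneg order_trans sum_nonneg)
  then have "c \<le> 0"
    using assms(1) by (simp add: zero_le_mult_iff)
  then have "hs_sq (op_grad u w x g) \<le> 0"
    using member_le_sum[of g S "\<lambda>g. hs_sq (op_grad u w x g)"] assms(2) finite_S hs_sq_nonneg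
    by (fastforce simp: c_def)
  then show ?thesis
    using hs_sq_nonneg[of "op_grad u w x g"] by (simp flip: hs_sq_eq_0_iff)
qed

text \<open>The Hilbert-Schmidt estimate bounds the left side by an average over the orbit; moved
  into the weights, this average is at most the form at the averaged weights, which are the images
  under the adjoint channel.\<close>

theorem weighted_gradient_estimate:
  assumes s: "s \<in> {0..1}" and A: "positive_op A" and B: "positive_op B"
  shows "weighted_form S A B s (op_grad u w (channel x)) (op_grad u w (channel x))
    \<le> complex_of_real (1 - \<kappa>) * weighted_form S (trace_adjoint channel A) (trace_adjoint channel B) s
        (op_grad u w x) (op_grad u w x)"
proof -
  let ?A = "\<lambda>h. adj (u h) ** A ** u h" and ?B = "\<lambda>h. adj (u h) ** B ** u h"
  let ?A' = "trace_adjoint channel A" and ?B' = "trace_adjoint channel B"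
  have A': "positive_op ?A'" and B': "positive_op ?B'"
    unfolding trace_adjoint_channel by (intro positive_op_sum positive_op_conj A B prob_nonneg; assumption)+
  have orbit: "power_form (orbit y h) s A B = power_form y s (?A h) (?B h)" if "h \<in> carrier G" for y h
    unfolding orbit_def by (rule power_form_unitary_conj[OF unitary_u[OF that] A B])
  have lieb: "(\<Sum>h\<in>carrier G. prob h * power_form y s (?A h) (?B h)) \<le> power_form y s ?A' ?B'" for y
    unfolding trace_adjoint_channel
    by (intro lieb_concavity finite_carrier prob_nonneg sum_prob positive_op_conj A B s)
  have "(\<Sum>g\<in>S. power_form (op_grad u w (channel x) g) s A B)
      \<le> (1 - \<kappa>) * (\<Sum>h\<in>carrier G. prob h * (\<Sum>g\<in>S. power_form (orbit (op_grad u w x g) h) s A B))"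
  proof (rule power_form_hs_sq[OF A B, of s])
    fix C D
    assume "\<And>y. trace (adj y ** op_powr A s ** y ** op_powr B (1 - s)) = complex_of_real (hs_sq (C ** y ** D))"
    then have "power_form y s A B = hs_sq (C ** y ** D)" for y
      by (simp add: power_form_def)
    then show ?thesis by (simp add: hs_gradient_estimate)
  qed
  also have "\<dots> \<le> (1 - \<kappa>) * (\<Sum>g\<in>S. power_form (op_grad u w x g) s ?A' ?B')"
  \<comment> \<open>Lieb's inequality can be multiplied by \<open>1 - \<kappa>\<close> only when
    this is nonnegative; otherwise all gradients vanish.\<close>
  proof (cases "\<kappa> \<le> 1")
    case True
    have "(\<Sum>h\<in>carrier G. prob h * (\<Sum>g\<in>S. power_form (orbit (op_grad u w x g) h) s A B))
        = (\<Sum>g\<in>S. \<Sum>h\<in>carrier G. prob h * power_form (op_grad u w x g) s (?A h) (?B h))"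
      by (simp add: orbit sum_distrib_left sum.swap[of _ S])
    also have "\<dots> \<le> (\<Sum>g\<in>S. power_form (op_grad u w x g) s ?A' ?B')"
      by (intro sum_mono lieb)
    finally show ?thesis using True by (intro mult_left_mono) auto
  next
    case False
    then have "op_grad u w x g = 0" if "g \<in> S" for g
      using op_grad_eq_0 that by simp
    moreover have "orbit 0 h = 0" for h
      using orbit_scaleR[of 0 0 h] by simp
    ultimately show ?thesis by (simp add: power_form_zero)
  qed
  finally show ?thesis
    unfolding weighted_form_power_form[OF A B] weighted_form_power_form[OF A' B']
    by (simp add: less_eq_complex_def)
qed

end

section \<open>Lipschitz estimates and Schatten norms\<close>

lemma lip_norm_cong:
  assumes "\<And>h. h \<in> carrier G \<Longrightarrow> f h = f' h"
  shows "lip_norm G S w f = lip_norm G S w f'"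
proof -
  have "{sqrt (w g) * cmod (f h - f (h \<otimes> g)) | h g. h \<in> carrier G \<and> g \<in> S}
      = {sqrt (w g) * cmod (f' h - f' (h \<otimes> g)) | h g. h \<in> carrier G \<and> g \<in> S}"
    using assms S_subset by (intro Collect_cong ex_cong1) auto
  then show ?thesis by (simp add: lip_norm_def)
qed

text \<open>By the intertwining relation, difference quotients of the scalar function are values of
  the functional on the orbit of the gradient. The square roots are nonnegative and come out of the
  modulus.\<close>

lemma lip_norm_orbit:
  assumes L: "linear L"
  shows "lip_norm G S w (\<lambda>h. L (orbit x h))
    = Sup (insert 0 {cmod (L (orbit (op_grad u w x g) h)) | h g. h \<in> carrier G \<and> g \<in> S})"
proof -
  have "sqrt (w g) * cmod (L (orbit x h) - L (orbit x (h \<otimes> g))) = cmod (L (orbit (op_grad u w x g) h))"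
    if "h \<in> carrier G" "g \<in> S" for h g
  proof -
    have "L (orbit (op_grad u w x g) h) = sqrt (w g) *\<^sub>R (L (orbit x (h \<otimes> g)) - L (orbit x h))"
      using grad_orbit[OF L _ that(1), of g x] that(2) S_subset by (auto simp: grad_def)
    then show ?thesis using weight_nonneg[OF that(2)] by (simp add: norm_minus_commute)
  qed
  then have "{sqrt (w g) * cmod (L (orbit x h) - L (orbit x (h \<otimes> g))) | h g. h \<in> carrier G \<and> g \<in> S}
      = {cmod (L (orbit (op_grad u w x g) h)) | h g. h \<in> carrier G \<and> g \<in> S}"
    by (intro Collect_cong ex_cong1) auto
  then show ?thesis by (simp add: lip_norm_def)
qed

context
  fixes \<kappa> :: real
  assumes lip_estimate: "\<And>f. lip_norm G S w (markov_map G k f) \<le> (1 - \<kappa>) * lip_norm G S w f"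
begin

theorem inf_schatten_gradient_estimate:
  "inf_schatten_norm S p (op_grad u w (channel x)) \<le> (1 - \<kappa>) * inf_schatten_norm S p (op_grad u w x)"
proof -
  define M where "M = inf_schatten_norm S p (op_grad u w x)"
  define lip where "lip A = lip_norm G S w (\<lambda>h. trace (A ** orbit x h))" for A
  have linear: "linear (\<lambda>y. trace (A ** y))" for A :: "complex ^ 'n ^ 'n"
    by (rule linearI) (simp_all add: matrix_add_ldistrib matrix_mul_scaleR_right trace_add trace_scaleR)
  note lip_orbit = lip_norm_orbit[OF linear]
  have bdd: "bdd_above {cmod (trace (A ** orbit (y g) h)) | h g. h \<in> carrier G \<and> g \<in> S}"
    for A :: "complex ^ 'n ^ 'n" and y
  proof -
    have "{cmod (trace (A ** orbit (y g) h)) | h g. h \<in> carrier G \<and> g \<in> S}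
        = (\<lambda>(h, g). cmod (trace (A ** orbit (y g) h))) ` (carrier G \<times> S)" by auto
    then show ?thesis using finite_carrier finite_S by simp
  qed
  \<comment> \<open>The point \<open>h = \<one>\<close> of the supremum recovers the gradient
    itself.\<close>
  have le_lip: "cmod (trace (A ** op_grad u w y g)) \<le> lip_norm G S w (\<lambda>h. trace (A ** orbit y h))"
    if "g \<in> S" for A y g
    unfolding lip_orbit
  proof (rule le_Sup_insert_0[OF bdd])
    have "cmod (trace (A ** op_grad u w y g)) = cmod (trace (A ** orbit (op_grad u w y g) \<one>))"
      by (simp add: orbit_one)
    then show "cmod (trace (A ** op_grad u w y g))
        \<in> insert 0 {cmod (trace (A ** orbit (op_grad u w y g) h)) | h g. h \<in> carrier G \<and> g \<in> S}"
      using that by blast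
  qed
  have lip_channel: "lip_norm G S w (\<lambda>h. trace (A ** orbit (channel x) h)) \<le> (1 - \<kappa>) * lip A" for A
  proof -
    \<comment> \<open>Equality of the two functions is available only on \<open>carrier G\<close>,
      which suffices for the seminorm.\<close>
    have "lip_norm G S w (markov_map G k (\<lambda>h. trace (A ** orbit x h)))
        = lip_norm G S w (\<lambda>h. trace (A ** orbit (channel x) h))"
      by (rule lip_norm_cong) (rule markov_map_orbit[OF linear])
    then show ?thesis using lip_estimate unfolding lip_def by metis
  qed
  have lip_nonneg: "0 \<le> lip_norm G S w (\<lambda>h. trace (A ** orbit y h))" for A y
    unfolding lip_orbit by (rule le_Sup_insert_0[OF bdd]) simp
  \<comment> \<open>Cyclicity moves \<open>u h\<close> from the gradient onto \<open>A\<close>, and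
    the conjugated \<open>A\<close> stays in the dual unit ball.\<close>
  have lip_le: "lip A \<le> M" if p': "1 / p + 1 / p' = 1" and A: "schatten_norm p' A \<le> 1" for A p'
    unfolding lip_def lip_orbit M_def
  proof (rule Sup_insert_0_le)
    note le_Sup = le_Sup_insert_0[OF bdd_above_inf_schatten_norm[OF finite_S]]
    show "0 \<le> inf_schatten_norm S p (op_grad u w x)"
      unfolding inf_schatten_norm_def by (rule le_Sup) simp
    fix r
    assume "r \<in> {cmod (trace (A ** orbit (op_grad u w x g) h)) | h g. h \<in> carrier G \<and> g \<in> S}"
    then obtain h g where r: "r = cmod (trace (A ** orbit (op_grad u w x g) h))"
      and h: "h \<in> carrier G" and g: "g \<in> S" by blast
    have "trace (A ** orbit (op_grad u w x g) h) = trace ((adj (u h) ** A ** u h) ** op_grad u w x g)"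
      using trace_mul_sym[of "adj (u h)" "A ** u h ** op_grad u w x g"]
      by (simp add: orbit_def matrix_mul_assoc)
    moreover have "schatten_norm p' (adj (u h) ** A ** u h) \<le> 1"
      using schatten_norm_unitary_conj[OF unitary_u[OF h]] A by (rule order_trans)
    ultimately show "r \<le> inf_schatten_norm S p (op_grad u w x)"
      unfolding inf_schatten_norm_def r using p' g by (intro le_Sup insertI2 CollectI exI conjI) simp_all
  qed
  have M_nonneg: "0 \<le> M"
    unfolding M_def inf_schatten_norm_def
    by (rule le_Sup_insert_0[OF bdd_above_inf_schatten_norm[OF finite_S]]) simp
  \<comment> \<open>A nonnegative seminorm is bounded by \<open>(1 - \<kappa>) * lip A\<close>, so a
    negative factor forces every \<open>lip A\<close>, and with it \<open>M\<close>, to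
    vanish.\<close>
  have M_le: "M \<le> 0" if "1 < \<kappa>"
    unfolding M_def inf_schatten_norm_def
  proof (rule Sup_insert_0_le)
    fix r
    assume "r \<in> {cmod (trace (A ** op_grad u w x g)) | A g p'.
      1 / p + 1 / p' = 1 \<and> schatten_norm p' A \<le> 1 \<and> g \<in> S}"
    then obtain A g where r: "r = cmod (trace (A ** op_grad u w x g))" and g: "g \<in> S" by blast
    have "0 \<le> (1 - \<kappa>) * lip A"
      using lip_nonneg lip_channel by (rule order_trans)
    then have "lip A \<le> 0" using that by (simp add: zero_le_mult_iff)
    then show "r \<le> 0" using le_lip[OF g, of A x] unfolding r lip_def by linarith
  qed simp
  \<comment> \<open>For \<open>\<kappa> \<le> 1\<close> this is \<open>lip_le\<close> scaled by a
    nonnegative factor; for larger \<kappa> the right side is zero.\<close>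
  have le: "(1 - \<kappa>) * lip A \<le> (1 - \<kappa>) * M"
    if "1 / p + 1 / p' = 1" "schatten_norm p' A \<le> 1" for A p'
  proof (cases "\<kappa> \<le> 1")
    case True
    then show ?thesis using lip_le[OF that] by (intro mult_left_mono) auto
  next
    case False
    then have "(1 - \<kappa>) * lip A \<le> 0" and "M = 0"
      using lip_nonneg[of A x] M_le M_nonneg by (auto simp: lip_def mult_le_0_iff)
    then show ?thesis by simp
  qed
  have "inf_schatten_norm S p (op_grad u w (channel x)) \<le> (1 - \<kappa>) * M"
    unfolding inf_schatten_norm_def
  proof (rule Sup_insert_0_le)
    show "0 \<le> (1 - \<kappa>) * M"
      using M_le M_nonneg by (cases "\<kappa> \<le> 1") auto
    fix r
    assume "r \<in> {cmod (trace (A ** op_grad u w (channel x) g)) | A g p'.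
      1 / p + 1 / p' = 1 \<and> schatten_norm p' A \<le> 1 \<and> g \<in> S}"
    then obtain A g p' where "r = cmod (trace (A ** op_grad u w (channel x) g))"
      and "1 / p + 1 / p' = 1" "schatten_norm p' A \<le> 1" and "g \<in> S" by blast
    then show "r \<le> (1 - \<kappa>) * M"
      using le_lip[of g A "channel x"] lip_channel[of A] le[of p' A] by linarith
  qed
  then show ?thesis by (simp add: M_def)
qed

end

end

theorem theorem5p4:
  fixes G :: "('a, 'm) monoid_scheme"
    and k w :: "'a \<Rightarrow> real"
    and u :: "'a \<Rightarrow> complex ^ 'n ^ 'n"
    and S :: "'a set"
    and \<kappa> :: real
  assumes "group G" and "finite (carrier G)"
    and "markov_kernel G k"
    and "projective_unitary_rep G u"
    and "S \<subseteq> carrier G" and "\<And>g. g \<in> S \<Longrightarrow> 0 < w g"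
  defines "K \<equiv> \<lambda>f :: 'a \<Rightarrow> complex. markov_map G k f"
    and "P \<equiv> transferred_channel G k u"
  shows
    "((\<forall>f :: 'a \<Rightarrow> complex. \<forall>h\<in>carrier G.
         grad_sq G S w (K f) h \<le> (1 - \<kappa>) * markov_map G k (grad_sq G S w f) h) \<longrightarrow>
      (\<forall>s\<in>{0..1}. \<forall>A B x. positive_op A \<longrightarrow> positive_op B \<longrightarrow>
         weighted_form S A B s (op_grad u w (P x)) (op_grad u w (P x))
           \<le> complex_of_real (1 - \<kappa>) *
              weighted_form S (trace_adjoint P A) (trace_adjoint P B) s (op_grad u w x) (op_grad u w x)))
     \<and>
     ((\<forall>f :: 'a \<Rightarrow> complex. lip_norm G S w (K f) \<le> (1 - \<kappa>) * lip_norm G S w f) \<longrightarrow>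
      (\<forall>p\<ge>1. \<forall>x.
         inf_schatten_norm S p (op_grad u w (P x)) \<le> (1 - \<kappa>) * inf_schatten_norm S p (op_grad u w x)))"
proof -
  interpret transference G k w u S
    by (intro transference.intro transference_axioms.intro assms less_imp_le)
  show ?thesis
    unfolding K_def P_def
    using weighted_gradient_estimate inf_schatten_gradient_estimate by blast
qed

end
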